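(* Let $d,m\in\mathbb{N}$ and let $T_1,\ldots,T_m$ be invertible $d\times d$ real matrices with $\|T_i\|<1/2$ for $1\le i\le m$. Suppose moreover that $T_iT_j=T_jT_i$ for all $1\le i,j\le m$ and that $\sum_{i=1}^m|\det(T_i)|^2>1$. Then for $\mathcal{L}^{md}$-a.e. $\mathbf{a}=(a_1,\ldots,a_m)\in\mathbb{R}^{md}$, the self-affine set $K^{\mathbf{a}}$ generated by the iterated function system $\{T_ix+a_i\}_{i=1}^m$ on $\mathbb{R}^d$ has non-empty interior.
   Context: $\|\cdot\|$ is the operator norm induced by the Euclidean norm on $\mathbb{R}^d$. For $\mathbf{a}=(a_1,\ldots,a_m)\in\mathbb{R}^{md}$ (each $a_i\in\mathbb{R}^d$), $K^{\mathbf{a}}$ is the unique non-empty compact set $K\subset\mathbb{R}^d$ with $K=\bigcup_{i=1}^m (T_iK+a_i)$. $\mathcal{L}^{md}$ is Lebesgue measure on $\mathbb{R}^{md}$. *)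

theory Defs
  imports "HOL-Analysis.Analysis"
begin

(* The index set {1..m} of the iterated function system is the finite type 'm, and
   R^(md) is real^'d^'m = (real^'d)^'m, with a $ i the i-th translation vector in real^'d.
   Its Euclidean structure is that of the md coordinates, so lebesgue on this type is
   md-dimensional Lebesgue measure.

   The description picks out a unique set whenever all maps x |-> T i *v x + a $ i
   are contractions (Hutchinson). *)
definition self_affine_set :: "('m::finite \<Rightarrow> real^'d^'d) \<Rightarrow> real^'d^'m \<Rightarrow> (real^'d) set" where
  "self_affine_set T a =
    (THE K. K \<noteq> {} \<and> compact K \<and> K = (\<Union>i. (\<lambda>x. T i *v x + a $ i) ` K))"

end

theory Submission
  imports Defs "HOL-Library.Multiset"
begin

text \<open>
  Because the matrices commute, the matrix \<open>T\<^sub>w\<close> of a word \<open>w\<close> depends only on how often each letter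
  occurs in \<open>w\<close>. Words of length \<open>n\<close> have polynomially many letter counts, while the sum of
  \<open>\<bar>det T\<^sub>w\<bar>\<^sup>2\<close> over these words is \<open>(\<Sum>\<^sub>i \<bar>det T\<^sub>i\<bar>\<^sup>2)\<^sup>n\<close> and grows exponentially. Hence for some \<open>n\<close> a class
  \<open>W\<close> of words of length \<open>n\<close> shares one matrix \<open>D\<close> and satisfies \<open>card W * \<bar>det D\<bar>\<^sup>2 > 1\<close>
  (\<open>exists_large_homogeneous_class\<close>).

  The maps of the words in \<open>W\<close> are \<open>x \<mapsto> D x + b\<^sub>w(a)\<close>, with \<open>b\<^sub>w\<close> linear in the translations \<open>a\<close>. Their
  attractor consists of the points \<open>\<Sum>\<^sub>k D\<^sup>k b\<close> with digits \<open>b\<close> chosen freely; separating even and odd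
  \<open>k\<close> shows that it is a sumset \<open>A + D A\<close>, where \<open>A\<close> is the attractor of the homogeneous system
  \<open>x \<mapsto> D\<^sup>2 x + b\<^sub>w(a)\<close>. So \<open>A + D A\<close> lies in the self-affine set
  (\<open>interleaved_sum_in_invariant_set\<close>). If \<open>A\<close> has positive measure, then so has \<open>D A\<close>, and by
  Steinhaus's argument the sumset has interior (\<open>sumset_interior_nonempty\<close>). It remains to see that
  \<open>A\<close> has positive measure for almost every \<open>a\<close>.

  For this, \<open>A\<close> is the decreasing intersection of unions of cylinders, one cylinder
  \<open>\<pi>\<^sub>u(a) + D\<^sup>2\<^sup>n B\<close> for every word \<open>u\<close> of \<open>n\<close> digits. By the Cauchy-Schwarz inequality such a
  union is large as soon as few pairs of cylinders meet (\<open>second_moment_union\<close>). The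
  number of meeting pairs, relative to \<open>((card W)\<^sup>2 * \<bar>det D\<bar>\<^sup>2)\<^sup>n\<close>, is bounded on average over \<open>a\<close>: if the first digits of \<open>u\<close> and \<open>v\<close> differ, the
  linear map \<open>a \<mapsto> \<pi>\<^sub>u(a) - \<pi>\<^sub>v(a)\<close> is transversal, that is, bounded below by a uniform multiple of the
  norm on some block \<open>a\<^sub>k\<close>, so the preimage of a set \<open>X\<close> has measure at most a constant times that of \<open>X\<close>. Summing
  over the length of the common prefix gives a geometric series of ratio
  \<open>1 / (card W * \<bar>det D\<bar>\<^sup>2) < 1\<close> (\<open>pair_energy_bound\<close>). Fatou's lemma turns the bound on average
  into one along a subsequence for almost every \<open>a\<close> (\<open>AE_positive_measure_attractor\<close>).

  Norms below \<open>1/2\<close> enter in the transversality. At the first letters \<open>i \<noteq> j\<close> where two words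
  differ, the blocks \<open>a\<^sub>i\<close> and \<open>a\<^sub>j\<close> have coefficients \<open>I + E\<^sub>i\<close> and \<open>-I + E\<^sub>j\<close>. Each later letter adds to the
  coefficient of one block only, so \<open>\<parallel>E\<^sub>i\<parallel> + \<parallel>E\<^sub>j\<parallel> \<le> 2 (t + t\<^sup>2 + \<dots>) = 2 t / (1 - t) < 2\<close>, and one of the
  two errors has norm below \<open>1\<close> (\<open>difference_form_expanding\<close>).
\<close>

section \<open>Lebesgue measure of linear images\<close>

lemma measure_translate_compact:
  fixes X :: "'a::euclidean_space set"
  assumes "compact X"
  shows "measure lborel ((+) c ` X) = measure lborel X"
proof -
  have "compact ((+) c ` X)"
    using assms by (simp add: compact_translation)
  then show ?thesis
    using measure_translation[of c X] assms by (simp add: measure_completion borel_compact)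
qed

lemma compact_linear_image:
  fixes f :: "'a::euclidean_space \<Rightarrow> 'b::real_normed_vector"
  assumes "linear f" "compact X"
  shows "compact (f ` X)"
  using assms by (intro compact_continuous_image linear_continuous_on)
    (auto simp: linear_conv_bounded_linear)

lemma measure_lebesgue_compact: "compact X \<Longrightarrow> measure lebesgue X = measure lborel X"
  for X :: "'a::euclidean_space set"
  by (simp add: borel_compact)

text \<open>Translations reduce an arbitrary box to one with lower corner \<open>0\<close>; this is the case in which a
  shear maps boxes to sets of known measure.\<close>

lemma measure_linear_image_compact_of_cbox:
  fixes f :: "real^'d \<Rightarrow> real^'d"
  assumes lin: "linear f" and X: "compact X" and det: "\<bar>det (matrix f)\<bar> = 1"
    and box: "\<And>b. measure lebesgue (f ` cbox 0 b) = measure lebesgue (cbox 0 b)"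
  shows "measure lborel (f ` X) = \<bar>det (matrix f)\<bar> * measure lborel X"
proof -
  have "measure lebesgue (f ` cbox a b) = measure lebesgue (cbox a b)" for a b
  proof -
    have *: "cbox a b = (+) a ` cbox 0 (b - a)"
      using cbox_translation[of a 0 "b - a"] by simp
    have "f ` cbox a b = (+) (f a) ` f ` cbox 0 (b - a)"
      unfolding * image_image by (simp add: linear_add[OF lin])
    then have "measure lebesgue (f ` cbox a b) = measure lebesgue (cbox 0 (b - a))"
      by (simp only: measure_translation box)
    also have "\<dots> = measure lebesgue (cbox a b)"
      unfolding * by (rule measure_translation[symmetric])
    finally show ?thesis .
  qed
  then have "measure lebesgue (f ` X) = 1 * measure lebesgue X"
    using measure_linear_sufficient[OF lin lmeasurable_compact[OF X], of 1] by simp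
  then show ?thesis
    using det X compact_linear_image[OF lin X] by (simp add: measure_lebesgue_compact)
qed

text \<open>The change of variables formula for linear maps, over an arbitrary finite index type. Every linear
  map is a product of coordinate scalings, coordinate swaps, shears and singular maps, and both sides
  are multiplicative. The determinants of swaps and shears come from row permutations and row
  operations on the identity matrix.\<close>

lemma measure_linear_image_compact:
  fixes f :: "real^'d \<Rightarrow> real^'d"
  assumes "linear f" "compact X"
  shows "measure lborel (f ` X) = \<bar>det (matrix f)\<bar> * measure lborel X"
proof -
  define P where "P = (\<lambda>f :: real^'d \<Rightarrow> real^'d. \<forall>X. compact X \<longrightarrow>
    measure lborel (f ` X) = \<bar>det (matrix f)\<bar> * measure lborel X)"
  have "P f"
  proof (rule induct_linear_elementary[OF assms(1)])
    fix f g :: "real^'d \<Rightarrow> real^'d"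
    assume fg: "linear f" "linear g" "P f" "P g"
    show "P (f \<circ> g)"
      unfolding P_def
    proof (intro allI impI)
      fix X :: "(real^'d) set" assume "compact X"
      then show "measure lborel ((f \<circ> g) ` X) = \<bar>det (matrix (f \<circ> g))\<bar> * measure lborel X"
        using fg compact_linear_image[OF fg(2)] unfolding image_comp[symmetric] P_def
        by (simp add: matrix_compose det_mul abs_mult)
    qed
  next
    fix f :: "real^'d \<Rightarrow> real^'d" and i
    assume f: "linear f" "\<And>x. f x $ i = 0"
    have "\<not> surj f"
      using f(2) by (metis axis_nth one_neq_zero surjD)
    then have ninj: "\<not> inj f" using linear_injective_imp_surjective[OF f(1)] by blast
    then have "det (matrix f) = 0" using det_nz_iff_inj[OF f(1)] by blast
    moreover have "measure lborel (f ` X) = 0" if "compact X" for X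
      using negligible_imp_measure0[OF negligible_linear_singular_image[OF f(1) ninj]]
        measure_lebesgue_compact[OF compact_linear_image[OF f(1) that]] by metis
    ultimately show "P f" by (simp add: P_def)
  next
    fix c :: "'d \<Rightarrow> real"
    let ?f = "\<lambda>x :: real^'d. \<chi> i. c i * x $ i"
    have lin: "linear ?f" by (rule linearI) (auto simp: vec_eq_iff algebra_simps)
    have "det (matrix ?f) = prod c UNIV"
      by (subst det_diagonal) (auto simp: matrix_def axis_def)
    then show "P ?f"
      using measure_stretch[OF lmeasurable_compact, of _ c]
      by (auto simp: P_def measure_lebesgue_compact compact_linear_image[OF lin] simp del: measure_completion)
  next
    fix m n :: 'd assume "m \<noteq> n"
    let ?\<tau> = "Transposition.transpose m n"
    let ?f = "\<lambda>x :: real^'d. \<chi> i. x $ ?\<tau> i"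
    have lin: "linear ?f" by (rule linearI) (auto simp: vec_eq_iff)
    have "matrix ?f = (\<chi> i. mat 1 $ ?\<tau> i)"
      by (auto simp: matrix_def vec_eq_iff mat_def axis_def)
    then have det: "\<bar>det (matrix ?f)\<bar> = 1"
      using det_permute_rows[OF permutes_swap_id[of m UNIV n], of "mat 1 :: real^'d^'d"]
      by (simp add: abs_mult sign_def)
    have "measure lebesgue (?f ` cbox 0 b) = measure lebesgue (cbox 0 b)" for b
    proof -
      have ff: "?f (?f x) = x" for x by (simp add: vec_eq_iff)
      have img: "?f ` cbox 0 b = cbox 0 (?f b)"
      proof
        show "?f ` cbox 0 b \<subseteq> cbox 0 (?f b)" by (auto simp: mem_box_cart)
        show "cbox 0 (?f b) \<subseteq> ?f ` cbox 0 b"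
        proof
          fix x assume x: "x \<in> cbox 0 (?f b)"
          have "?f x \<in> cbox 0 b"
          proof -
            have "0 \<le> x $ ?\<tau> i \<and> x $ ?\<tau> i \<le> b $ i" for i
              using x[unfolded mem_box_cart, rule_format, of "?\<tau> i"] by simp
            then show ?thesis by (simp add: mem_box_cart)
          qed
          then show "x \<in> ?f ` cbox 0 b" by (metis ff image_eqI)
        qed
      qed
      show ?thesis
      proof (cases "cbox 0 b = {}")
        case False
        then have ne: "cbox 0 (?f b) \<noteq> {}" using img by (metis image_is_empty)
        have "(\<Prod>i\<in>UNIV. b $ ?\<tau> i) = (\<Prod>i\<in>UNIV. b $ i)"
          using prod.permute[OF permutes_swap_id[of m UNIV n], of "($) b"] by (simp add: o_def)
        then show ?thesis unfolding img using False ne by (simp add: content_cbox_cart)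
      qed simp
    qed
    then show "P ?f"
      using measure_linear_image_compact_of_cbox[OF lin _ det] by (simp add: P_def)
  next
    fix m n :: 'd assume mn: "m \<noteq> n"
    let ?f = "\<lambda>x :: real^'d. \<chi> i. if i = m then x $ m + x $ n else x $ i"
    have lin: "linear ?f" by (rule linearI) (auto simp: vec_eq_iff algebra_simps)
    have "matrix ?f = (\<chi> k. if k = m then row m (mat 1) + 1 *s row n (mat 1) else row k (mat 1))"
      by (auto simp: matrix_def vec_eq_iff mat_def axis_def row_def)
    then have "det (matrix ?f) = 1"
      using det_row_operation[OF mn, of "mat 1 :: real^'d^'d" 1] by simp
    moreover have "measure lebesgue (?f ` cbox 0 b) = measure lebesgue (cbox 0 b)" for b
      using measure_shear_interval[OF mn, of 0 b] by (cases "cbox 0 b = {}") auto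
    ultimately show "P ?f"
      using measure_linear_image_compact_of_cbox[OF lin] by (simp add: P_def)
  qed
  then show ?thesis using assms(2) by (simp add: P_def)
qed

lemma measure_lborel_mono_compact:
  fixes X Y :: "'a::euclidean_space set"
  assumes "X \<subseteq> Y" "compact Y" "X \<in> sets borel"
  shows "measure lborel X \<le> measure lborel Y"
  using assms by (intro measure_mono_fmeasurable) (auto intro: fmeasurable_compact)

section \<open>Preimages under transversal linear maps\<close>

lemma linear_expanding_bij:
  fixes f :: "real^'d \<Rightarrow> real^'d"
  assumes "linear f" "c > 0" "\<And>x. c * norm x \<le> norm (f x)"
  shows "bij f"
proof -
  have "inj f"
    unfolding linear_injective_0[OF assms(1)]
  proof (intro allI impI)
    fix x assume "f x = 0"
    then have "c * norm x \<le> 0" using assms(3)[of x] by simp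
    then show "x = 0" using assms(2) by (simp add: mult_le_0_iff)
  qed
  then show ?thesis
    using linear_injective_imp_surjective[OF assms(1)] by (simp add: bij_def)
qed

text \<open>The image of the unit ball contains the ball of radius \<open>c\<close>; compare volumes.\<close>

lemma det_lower_bound_of_expanding:
  fixes f :: "real^'d \<Rightarrow> real^'d"
  assumes "linear f" "c > 0" "\<And>x. c * norm x \<le> norm (f x)"
  shows "c ^ CARD('d) \<le> \<bar>det (matrix f)\<bar>"
proof -
  let ?B = "cball (0::real^'d) 1"
  have "cball (0::real^'d) c \<subseteq> f ` ?B"
  proof
    fix y :: "real^'d" assume y: "y \<in> cball 0 c"
    obtain x where x: "y = f x"
      using linear_expanding_bij[OF assms] by (metis bij_pointE)
    have "c * norm x \<le> c * 1"
      using assms(3)[of x] y x by simp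
    then have "norm x \<le> 1"
      using assms(2) by (simp only: mult_le_cancel_left_pos)
    then show "y \<in> f ` ?B" using x by simp
  qed
  then have "measure lborel (cball (0::real^'d) c) \<le> measure lborel (f ` ?B)"
    using assms(1) by (intro measure_lborel_mono_compact) (auto intro!: compact_linear_image)
  also have "\<dots> = \<bar>det (matrix f)\<bar> * measure lborel ?B"
    using assms(1) by (simp add: measure_linear_image_compact)
  finally have "c ^ CARD('d) * unit_ball_vol (real CARD('d)) \<le>
      \<bar>det (matrix f)\<bar> * unit_ball_vol (real CARD('d))"
    using assms(2) by (simp add: content_cball mult.commute)
  then show ?thesis
    using unit_ball_vol_pos[of "real CARD('d)"] by simp
qed

lemma measure_preimage_of_expanding:
  fixes f :: "real^'d \<Rightarrow> real^'d"
  assumes "linear f" "c > 0" "\<And>x. c * norm x \<le> norm (f x)" "compact X"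
  shows "compact {y. v + f y \<in> X}"
    and "measure lborel {y. v + f y \<in> X} \<le> measure lborel X / c ^ CARD('d)"
proof -
  let ?Y = "{y. v + f y \<in> X}"
  have bl: "bounded_linear f" using assms(1) by (simp add: linear_conv_bounded_linear)
  have "closed ?Y"
    using closed_vimage[of X "\<lambda>y. v + f y"] assms(4) bl
    by (simp add: vimage_def compact_imp_closed linear_continuous_on continuous_intros)
  moreover obtain K where K: "\<And>x. x \<in> X \<Longrightarrow> norm x \<le> K"
    using compact_imp_bounded[OF assms(4)] by (auto simp: bounded_iff)
  have "norm y \<le> (K + norm v) / c" if "y \<in> ?Y" for y
  proof -
    have "c * norm y \<le> norm ((v + f y) - v)" using assms(3) by simp
    also have "\<dots> \<le> K + norm v"
      using K[of "v + f y"] that norm_triangle_ineq4[of "v + f y" v] by simp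
    finally show ?thesis using assms(2) by (simp add: field_simps)
  qed
  then have "bounded ?Y" by (auto simp: bounded_iff)
  ultimately show cY: "compact ?Y" by (simp add: compact_eq_bounded_closed)
  have "measure lborel (f ` ?Y) \<le> measure lborel ((+) (- v) ` X)"
  proof (rule measure_lborel_mono_compact)
    show "f ` ?Y \<subseteq> (+) (- v) ` X" by force
    show "compact ((+) (- v) ` X)" using assms(4) by (rule compact_translation)
    show "f ` ?Y \<in> sets borel"
      using cY bl by (intro borel_compact compact_continuous_image linear_continuous_on)
  qed
  also have "\<dots> = measure lborel X" using assms(4) by (rule measure_translate_compact)
  finally have *: "\<bar>det (matrix f)\<bar> * measure lborel ?Y \<le> measure lborel X"
    using measure_linear_image_compact[OF assms(1) cY] by simp
  have "c ^ CARD('d) * measure lborel ?Y \<le> \<bar>det (matrix f)\<bar> * measure lborel ?Y"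
    using det_lower_bound_of_expanding[OF assms(1-3)] by (intro mult_right_mono) auto
  then show "measure lborel ?Y \<le> measure lborel X / c ^ CARD('d)"
    using * assms(2) by (simp add: field_simps)
qed

lemma emeasure_compact_eq: "compact X \<Longrightarrow> emeasure lborel X = ennreal (measure lborel X)"
  for X :: "'a::euclidean_space set"
  by (metis emeasure_compact_finite emeasure_eq_ennreal_measure less_irrefl infinity_ennreal_def)

lemma norm_axis: "norm (axis i x) = norm x"
  for x :: "'a::real_normed_vector"
proof -
  have "(\<Sum>j\<in>UNIV. (norm (axis i x $ j))\<^sup>2) = (\<Sum>j\<in>UNIV. if j = i then (norm x)\<^sup>2 else 0)"
    by (intro sum.cong) (auto simp: axis_def)
  then show ?thesis by (simp add: norm_vec_def L2_set_def)
qed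

text \<open>A linear map that expands one block of coordinates pulls small sets back to small sets, at a
  rate depending only on the expansion factor. The set \<open>Y\<close> on the left is averaged over its translates
  by vectors \<open>axis i y\<close> with \<open>y\<close> in the unit ball. After exchanging the integrals, the inner integral
  is over a single block, where it is the measure of a preimage under an expanding map. Averaging
  replaces a decomposition of the parameter space into a product.\<close>

lemma transversal_linear_preimage:
  fixes z :: "real^'d^'m::finite \<Rightarrow> real^'d"
  assumes "linear z" "c > 0" "\<And>x. c * norm x \<le> norm (z (axis i x))" "compact X"
  shows "measure lborel {a \<in> cball 0 r. z a \<in> X} \<le>
    measure lborel (cball (0::real^'d^'m) (r + 1)) / (c ^ CARD('d) * measure lborel (cball (0::real^'d) 1))
      * measure lborel X"
proof -
  define Y where "Y = {a \<in> cball 0 r. z a \<in> X}"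
  let ?U = "cball (0::real^'d) 1"
  let ?C = "cball (0::real^'d^'m) (r + 1)"
  have blz: "bounded_linear z" using assms(1) by (simp add: linear_conv_bounded_linear)
  have "closed (z -` X)"
    using blz assms(4) by (intro closed_vimage) (auto simp: compact_imp_closed linear_continuous_on)
  then have "compact (cball 0 r \<inter> z -` X)" by (intro compact_Int_closed) auto
  moreover have "Y = cball 0 r \<inter> z -` X" by (auto simp: Y_def)
  ultimately have cY: "compact Y" by simp
  define f where "f = (\<lambda>x. z (axis i x))"
  have ax: "linear (axis i :: real^'d \<Rightarrow> real^'d^'m)"
    by (intro linearI) (auto simp: axis_def vec_eq_iff)
  have expf: "c * norm x \<le> norm (f x)" for x
    using assms(3) by (simp add: f_def)
  have linf: "linear f"
    unfolding f_def using linear_compose[OF ax assms(1)] by (simp add: o_def)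
  have [measurable]: "(axis i :: real^'d \<Rightarrow> real^'d^'m) \<in> borel_measurable borel"
    using ax by (simp add: borel_measurable_continuous_onI linear_continuous_on linear_conv_bounded_linear)
  have [measurable]: "Y \<in> sets borel" using cY by (rule borel_compact)
  have normax: "norm (axis i x :: real^'d^'m) = norm x" for x :: "real^'d"
    by (rule norm_axis)
  have "emeasure lborel Y * emeasure lborel ?U
      = (\<integral>\<^sup>+ y. indicator ?U y * emeasure lborel Y \<partial>lborel)"
    by (subst nn_integral_multc) (auto simp: mult.commute intro!: borel_measurable_indicator)
  also have "\<dots> = (\<integral>\<^sup>+ y. (\<integral>\<^sup>+ a. indicator ?U y * indicator Y (axis i y + a) \<partial>lborel) \<partial>lborel)"
  proof (rule nn_integral_cong)
    fix y :: "real^'d"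
    have "emeasure lborel Y = (\<integral>\<^sup>+ a. indicator Y a \<partial>distr lborel borel ((+) (axis i y)))"
      by (simp add: lborel_distr_plus)
    also have "\<dots> = (\<integral>\<^sup>+ a. indicator Y (axis i y + a) \<partial>lborel)"
      by (subst nn_integral_distr) auto
    finally show "indicator ?U y * emeasure lborel Y
        = (\<integral>\<^sup>+ a. indicator ?U y * indicator Y (axis i y + a) \<partial>lborel)"
      by (simp add: nn_integral_cmult)
  qed
  also have "\<dots> = (\<integral>\<^sup>+ a. (\<integral>\<^sup>+ y. indicator ?U y * indicator Y (axis i y + a) \<partial>lborel) \<partial>lborel)"
  proof (rule lborel_pair.Fubini')
    have [measurable]: "?U \<in> sets borel" by simp
    have [measurable]: "(\<lambda>x :: (real^'d^'m) \<times> (real^'d). axis i (snd x) + fst x) \<in> borel_measurable (borel \<Otimes>\<^sub>M borel)"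
      by (intro borel_measurable_add measurable_compose[OF measurable_snd] measurable_fst) fact
    have "(\<lambda>x. indicator ?U (snd x) * indicator Y (axis i (snd x) + fst x) :: ennreal) \<in> borel_measurable (borel \<Otimes>\<^sub>M borel)"
      by measurable
    also have "borel_measurable (borel \<Otimes>\<^sub>M borel) = borel_measurable (lborel \<Otimes>\<^sub>M lborel)"
      by (intro measurable_cong_sets sets_pair_measure_cong) auto
    finally show "(\<lambda>(a, y). indicator ?U y * indicator Y (axis i y + a) :: ennreal) \<in> borel_measurable (lborel \<Otimes>\<^sub>M lborel)"
      by (simp only: case_prod_unfold)
  qed
  also have "\<dots> \<le> (\<integral>\<^sup>+ a. indicator ?C a * ennreal (measure lborel X / c ^ CARD('d)) \<partial>lborel)"
  proof (rule nn_integral_mono)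
    fix a :: "real^'d^'m"
    let ?P = "{y. z a + f y \<in> X}"
    note P = measure_preimage_of_expanding[OF linf assms(2) expf assms(4), of "z a"]
    have le: "indicator ?U y * indicator Y (axis i y + a) \<le> indicator ?C a * (indicator ?P y :: ennreal)" for y
    proof (cases "y \<in> ?U \<and> axis i y + a \<in> Y")
      case True
      have "norm a \<le> norm (axis i y + a) + norm (axis i y :: real^'d^'m)"
        by (metis add.commute add_diff_cancel_left' norm_triangle_ineq4)
      with True normax have "a \<in> ?C" by (auto simp: Y_def)
      moreover have "z a + f y = z (axis i y + a)"
        unfolding f_def by (simp add: linear_add[OF assms(1)] add.commute)
      then have "y \<in> ?P" using True by (simp add: Y_def)
      ultimately show ?thesis using True by simp
    qed auto
    have "(\<integral>\<^sup>+ y. indicator ?U y * indicator Y (axis i y + a) \<partial>lborel)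
        \<le> (\<integral>\<^sup>+ y. indicator ?C a * indicator ?P y \<partial>lborel)"
      by (intro nn_integral_mono le)
    also have "\<dots> = indicator ?C a * ennreal (measure lborel ?P)"
      unfolding emeasure_compact_eq[OF P(1), symmetric]
      using P(1) by (intro nn_integral_cmult_indicator) (simp add: borel_compact)
    also have "\<dots> \<le> indicator ?C a * ennreal (measure lborel X / c ^ CARD('d))"
      using P(2) by (intro mult_left_mono ennreal_leI) auto
    finally show "(\<integral>\<^sup>+ y. indicator ?U y * indicator Y (axis i y + a) \<partial>lborel)
        \<le> indicator ?C a * ennreal (measure lborel X / c ^ CARD('d))" .
  qed
  also have "\<dots> = emeasure lborel ?C * ennreal (measure lborel X / c ^ CARD('d))"
    by (subst nn_integral_multc) (auto intro!: borel_measurable_indicator)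
  finally have "measure lborel Y * measure lborel ?U
      \<le> measure lborel ?C * (measure lborel X / c ^ CARD('d))"
    using cY assms(2) by (simp add: emeasure_compact_eq flip: ennreal_mult)
  moreover have "measure lborel ?U > 0" by (simp add: content_cball)
  ultimately show ?thesis
    using assms(2) by (simp add: field_simps Y_def)
qed

section \<open>Sumsets of compact sets of positive measure\<close>

text \<open>Steinhaus's theorem for compact sets: choose an open neighbourhood of \<open>C\<close> with measure less than
  twice that of \<open>C\<close>. A small translate of \<open>C\<close> still lies in it, hence cannot be disjoint from \<open>C\<close>.\<close>

lemma positive_measure_translates_meet:
  fixes C :: "'a::euclidean_space set"
  assumes "compact C" "measure lborel C > 0"
  obtains \<delta> where "\<delta> > 0" "\<And>z. norm z < \<delta> \<Longrightarrow> \<exists>c\<in>C. \<exists>c'\<in>C. c = c' + z"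
proof -
  let ?L = "measure lborel :: 'a set \<Rightarrow> real"
  have Cm: "C \<in> lmeasurable" using assms(1) by (rule lmeasurable_compact)
  obtain U where U: "open U" "C \<subseteq> U" "U - C \<in> lmeasurable"
    "emeasure lebesgue (U - C) < ennreal (?L C)"
    using sets_lebesgue_outer_open[OF fmeasurableD[OF Cm] assms(2)] by metis
  have "emeasure lebesgue (U - C) = ennreal (measure lebesgue (U - C))"
    using U(3) by (simp add: emeasure_eq_measure2)
  then have small: "measure lebesgue (U - C) < ?L C"
    using U(4) assms(2) by (simp add: ennreal_less_iff)
  obtain \<delta> where \<delta>: "\<delta> > 0" "\<And>x y. x \<in> C \<Longrightarrow> y \<notin> U \<Longrightarrow> \<delta> \<le> dist x y"
    using separate_compact_closed[OF assms(1), of "- U"] U(1,2) by (force simp: closed_Compl)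
  show thesis
  proof (rule that[OF \<delta>(1)])
    fix z :: 'a assume z: "norm z < \<delta>"
    show "\<exists>c\<in>C. \<exists>c'\<in>C. c = c' + z"
    proof (rule ccontr)
      assume neg: "\<not> ?thesis"
      have cz: "compact ((+) z ` C)" using assms(1) by (simp add: compact_translation)
      have "(+) z ` C \<subseteq> U - C"
      proof
        fix w assume "w \<in> (+) z ` C"
        then obtain x where x: "x \<in> C" "w = z + x" by auto
        have "w \<notin> C" using neg x by (metis add.commute)
        moreover have "w \<in> U"
        proof (rule ccontr)
          assume "w \<notin> U"
          then have "\<delta> \<le> dist x w" using \<delta>(2) x(1) by blast
          then show False using z x(2) by (simp add: dist_norm)
        qed
        ultimately show "w \<in> U - C" by simp
      qed
      then have "measure lebesgue ((+) z ` C) \<le> measure lebesgue (U - C)"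
        using U(3) lmeasurable_compact[OF cz] by (intro measure_mono_fmeasurable) auto
      moreover have "measure lebesgue ((+) z ` C) = ?L C"
        using assms(1) by (simp add: measure_translation measure_completion borel_compact)
      ultimately show False using small by simp
    qed
  qed
qed

text \<open>The measure of \<open>A \<inter> (x - B)\<close> integrates over \<open>x\<close> to the product of the measures of \<open>A\<close> and \<open>B\<close>.
  So some \<open>A \<inter> (x - B)\<close> has positive measure, and Steinhaus's theorem for this set puts a ball around
  \<open>x\<close> into the sumset.\<close>

lemma sumset_interior_nonempty:
  fixes A B :: "'a::euclidean_space set"
  assumes "compact A" "compact B" "measure lborel A > 0" "measure lborel B > 0"
    and sub: "\<And>x y. x \<in> A \<Longrightarrow> y \<in> B \<Longrightarrow> x + y \<in> H"
  shows "interior H \<noteq> {}"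
proof -
  have [measurable]: "A \<in> sets borel" "B \<in> sets borel" using assms by (auto simp: borel_compact)
  define C where "C = (\<lambda>x. A \<inter> (\<lambda>y. x - y) ` B)"
  have cC: "compact (C x)" for x
  proof -
    have "compact ((\<lambda>y. x - y) ` B)"
      using assms(2) by (intro compact_continuous_image) (auto intro: continuous_intros)
    then show ?thesis unfolding C_def using assms(1) by (rule compact_Int[rotated])
  qed
  have "\<exists>x. measure lborel (C x) > 0"
  proof (rule ccontr)
    assume "\<not> ?thesis"
    then have z: "measure lborel (C x) = 0" for x
      by (metis measure_nonneg less_eq_real_def)
    have "emeasure lborel A * emeasure lborel B
        = (\<integral>\<^sup>+ a. indicator A a * emeasure lborel B \<partial>lborel)"
      by (simp add: nn_integral_multc)
    also have "\<dots> = (\<integral>\<^sup>+ a. (\<integral>\<^sup>+ x. indicator A a * indicator B (- a + x) \<partial>lborel) \<partial>lborel)"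
    proof (rule nn_integral_cong)
      fix a :: 'a
      have "emeasure lborel B = (\<integral>\<^sup>+ b. indicator B b \<partial>distr lborel borel ((+) (- a)))"
        by (simp add: lborel_distr_plus)
      also have "\<dots> = (\<integral>\<^sup>+ b. indicator B (- a + b) \<partial>lborel)"
        by (subst nn_integral_distr) auto
      finally show "indicator A a * emeasure lborel B
          = (\<integral>\<^sup>+ x. indicator A a * indicator B (- a + x) \<partial>lborel)"
        by (simp add: nn_integral_cmult)
    qed
    also have "\<dots> = (\<integral>\<^sup>+ x. (\<integral>\<^sup>+ a. indicator A a * indicator B (- a + x) \<partial>lborel) \<partial>lborel)"
      by (rule lborel_pair.Fubini') measurable
    also have "\<dots> = (\<integral>\<^sup>+ x. (\<integral>\<^sup>+ a. indicator (C x) a \<partial>lborel) \<partial>(lborel :: 'a measure))"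
    proof (intro nn_integral_cong)
      fix x a :: 'a
      have "a \<in> (\<lambda>y. x - y) ` B \<longleftrightarrow> - a + x \<in> B" by (force simp: algebra_simps)
      then show "indicator A a * indicator B (- a + x) = (indicator (C x) a :: ennreal)"
        by (auto simp: C_def indicator_def)
    qed
    also have "\<dots> = (\<integral>\<^sup>+ x. ennreal (measure lborel (C x)) \<partial>(lborel :: 'a measure))"
      using cC by (simp add: borel_compact emeasure_compact_eq)
    also have "\<dots> = 0" by (simp add: z)
    finally show False using assms by (simp add: emeasure_compact_eq flip: ennreal_mult)
  qed
  then obtain x where x: "measure lborel (C x) > 0" by blast
  obtain \<delta> where \<delta>: "\<delta> > 0" "\<And>z. norm z < \<delta> \<Longrightarrow> \<exists>c\<in>C x. \<exists>c'\<in>C x. c = c' + z"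
    using positive_measure_translates_meet[OF cC x] by metis
  have "ball x \<delta> \<subseteq> H"
  proof
    fix w assume "w \<in> ball x \<delta>"
    then obtain c c' where c: "c \<in> C x" "c' \<in> C x" "c = c' + (w - x)"
      using \<delta>(2)[of "w - x"] by (auto simp: dist_norm norm_minus_commute)
    then obtain y where "y \<in> B" "c' = x - y" by (auto simp: C_def)
    then have "w = c + y" using c(3) by simp
    then show "w \<in> H" using sub[of c y] c(1) \<open>y \<in> B\<close> by (simp add: C_def)
  qed
  then have "x \<in> interior H" using \<delta>(1) by (meson mem_interior)
  then show ?thesis by blast
qed

section \<open>Words and coded points\<close>

text \<open>The image of \<open>0\<close> under the composition of the affine maps \<open>x \<mapsto> T i x + c i a\<close> along a word. The
  letters may be words themselves: this single recursion gives the translation part of a word over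
  the original system and the points of the homogeneous system whose digits are such words.\<close>

primrec code_point ::
    "('i \<Rightarrow> real^'d^'d) \<Rightarrow> ('i \<Rightarrow> 'p \<Rightarrow> real^'d) \<Rightarrow> 'i list \<Rightarrow> 'p \<Rightarrow> real^'d" where
  "code_point T c [] a = 0"
| "code_point T c (i # w) a = c i a + T i *v code_point T c w a"

definition words :: "'i set \<Rightarrow> nat \<Rightarrow> 'i list set" where
  "words W n = {u. set u \<subseteq> W \<and> length u = n}"

lemma words_0 [simp]: "words W 0 = {[]}"
  by (auto simp: words_def)

lemma words_Suc: "words W (Suc n) = (\<lambda>(w, u). w # u) ` (W \<times> words W n)"
  by (auto simp: words_def length_Suc_conv image_iff)

lemma finite_words [simp]: "finite W \<Longrightarrow> finite (words W n)"
  by (simp add: words_def finite_lists_length_eq)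

lemma card_words [simp]: "finite W \<Longrightarrow> card (words W n) = card W ^ n"
  by (simp add: words_def card_lists_length_eq)

lemma sum_words_Suc:
  "(\<Sum>u\<in>words W (Suc n). f u) = (\<Sum>w\<in>W. \<Sum>u\<in>words W n. f (w # u))"
proof -
  have "inj_on (\<lambda>(w, u). w # u) (W \<times> words W n)" by (auto simp: inj_on_def)
  then have "(\<Sum>u\<in>words W (Suc n). f u) = (\<Sum>(w, u)\<in>W \<times> words W n. f (w # u))"
    unfolding words_Suc by (subst sum.reindex) (auto intro: sum.cong)
  then show ?thesis by (simp add: sum.cartesian_product)
qed

lemma continuous_code_point:
  fixes c :: "'i \<Rightarrow> 'p::topological_space \<Rightarrow> real^'d"
  assumes "\<And>i. i \<in> W \<Longrightarrow> continuous_on UNIV (c i)" "set u \<subseteq> W"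
  shows "continuous_on UNIV (code_point T c u)"
  using assms(2)
proof (induction u)
  case Nil
  have "code_point T c [] = (\<lambda>_. 0)" by (simp add: fun_eq_iff)
  then show ?case by simp
next
  case (Cons i u)
  have "code_point T c (i # u) = (\<lambda>a. c i a + T i *v code_point T c u a)" by (simp add: fun_eq_iff)
  then show ?case using Cons assms(1) by (auto intro!: continuous_intros matrix_vector_mult_linear_continuous_on
      continuous_on_compose2[OF matrix_vector_mult_linear_continuous_on[of UNIV]])
qed

abbreviation pow_image :: "real^'d^'d \<Rightarrow> nat \<Rightarrow> (real^'d) set \<Rightarrow> (real^'d) set" where
  "pow_image S n \<equiv> image ((*v) S) ^^ n"

lemma compact_pow_image: "compact X \<Longrightarrow> compact (pow_image S n X)"
  by (induction n) (auto intro: compact_linear_image)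

lemma measure_pow_image:
  "compact X \<Longrightarrow> measure lborel (pow_image S n X) = \<bar>det S\<bar> ^ n * measure lborel X"
  by (induction n) (auto simp: measure_linear_image_compact compact_pow_image)

lemma pow_image_diff:
  assumes "p \<in> pow_image S n (cball 0 r)" "q \<in> pow_image S n (cball 0 s)"
  shows "p - q \<in> pow_image S n (cball 0 (r + s))"
  using assms
proof (induction n arbitrary: p q)
  case 0
  then show ?case using norm_triangle_ineq4[of p q] by simp
next
  case (Suc n)
  then obtain p' q' where "p = S *v p'" "p' \<in> pow_image S n (cball 0 r)"
    "q = S *v q'" "q' \<in> pow_image S n (cball 0 s)" by auto
  then show ?case using Suc.IH[of p' q'] by (auto simp: matrix_vector_mult_diff_distrib[symmetric])
qed

lemma compact_preimage_in_compact:
  fixes f :: "'p::euclidean_space \<Rightarrow> real^'d"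
  assumes "continuous_on UNIV f" "compact Q" "compact X"
  shows "compact {a \<in> Q. f a \<in> X}"
proof -
  have "closed (f -` X)" using assms by (intro closed_vimage) (auto simp: compact_imp_closed)
  then have "compact (Q \<inter> f -` X)" using assms(2) by (intro compact_Int_closed)
  moreover have "{a \<in> Q. f a \<in> X} = Q \<inter> f -` X" by auto
  ultimately show ?thesis by simp
qed

section \<open>Energy estimate for homogeneous systems\<close>

text \<open>When \<open>B\<close> is the doubled ball, the left-hand side bounds the integral over \<open>Q\<close> of the number of pairs
  of cylinders of level \<open>n\<close> that meet. Pairs with
  the same first digit reduce to level \<open>n - 1\<close> after applying the inverse of \<open>S\<close>, and there are
  \<open>card W\<close> choices of that digit; pairs with different first digits are controlled by
  transversality. Relative to the normalisation \<open>((card W)\<^sup>2 * \<bar>det S\<bar>)\<^sup>n\<close> this is the recursion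
  \<open>e\<^sub>n\<^sub>+\<^sub>1 \<le> e\<^sub>n / (card W * \<bar>det S\<bar>) + const\<close>, which stays bounded since \<open>card W * \<bar>det S\<bar> > 1\<close>.\<close>

lemma pair_energy_bound:
  fixes S :: "real^'d^'d" and b :: "'w \<Rightarrow> 'p::euclidean_space \<Rightarrow> real^'d"
  defines "\<pi> \<equiv> code_point (\<lambda>_. S) b"
  assumes finW: "finite W" and cont: "\<And>w. w \<in> W \<Longrightarrow> continuous_on UNIV (b w)"
    and inv: "invertible S" and big: "1 < real (card W) * \<bar>det S\<bar>"
    and Q: "compact Q" and B: "compact B" and C: "0 \<le> C"
    and transv: "\<And>w v u u' X. \<lbrakk>w \<in> W; v \<in> W; w \<noteq> v; set u \<subseteq> W; set u' \<subseteq> W; compact X\<rbrakk> \<Longrightarrow>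
      measure lborel {a \<in> Q. \<pi> (w # u) a - \<pi> (v # u') a \<in> X} \<le> C * measure lborel X"
  shows "\<exists>K. \<forall>n. (\<Sum>u\<in>words W n. \<Sum>v\<in>words W n.
      measure lborel {a \<in> Q. \<pi> u a - \<pi> v a \<in> pow_image S n B})
    \<le> K * ((real (card W))\<^sup>2 * \<bar>det S\<bar>) ^ n"
proof -
  define N where "N = real (card W)"
  define \<delta> where "\<delta> = \<bar>det S\<bar>"
  define \<beta> where "\<beta> = measure lborel B"
  define e where "e = (\<lambda>n u v. measure lborel {a \<in> Q. \<pi> u a - \<pi> v a \<in> pow_image S n B})"
  define E where "E = (\<lambda>n. \<Sum>u\<in>words W n. \<Sum>v\<in>words W n. e n u v)"
  \<comment> \<open>\<open>K\<close> dominates the value at level \<open>0\<close> and the fixed point of the recursion \<open>e \<mapsto> e / (N \<delta>) + C \<beta>\<close>.\<close>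
  define K where "K = max (measure lborel Q) (C * \<beta> / (1 - 1 / (N * \<delta>)))"
  have N\<delta>: "1 < N * \<delta>" using big by (simp add: N_def \<delta>_def)
  have \<delta>0: "0 < \<delta>" using inv by (simp add: \<delta>_def invertible_det_nz)
  have N0: "0 < N" using N\<delta> \<delta>0 by (metis less_trans zero_less_one zero_less_mult_pos2)
  have gap: "0 < 1 - 1 / (N * \<delta>)" using N\<delta> by (simp add: field_simps)
  have K2: "K / (N * \<delta>) + C * \<beta> \<le> K"
  proof -
    have "C * \<beta> / (1 - 1 / (N * \<delta>)) \<le> K" by (simp add: K_def)
    then have "C * \<beta> \<le> K * (1 - 1 / (N * \<delta>))" using gap by (simp only: pos_divide_le_eq)
    then show ?thesis by (simp add: algebra_simps)
  qed
  have \<beta>0: "0 \<le> \<beta>" by (simp add: \<beta>_def)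
  have injS: "S *v x = S *v y \<longleftrightarrow> x = y" for x y
    using inv by (metis invertible_def matrix_vector_mul_assoc matrix_vector_mul_lid)
  have rec: "E (Suc n) \<le> N * E n + (N\<^sup>2 * \<delta>) ^ Suc n * (C * \<beta>)" for n
  proof -
    define c where "c = C * (\<delta> ^ Suc n * \<beta>)"
    have c0: "0 \<le> c" using C \<delta>0 \<beta>0 by (simp add: c_def)
    have block: "e (Suc n) (w # u) (v # u') \<le> (if w = v then e n u u' else 0) + c"
      if "w \<in> W" "v \<in> W" "u \<in> words W n" "u' \<in> words W n" for w v u u'
    proof (cases "w = v")
      case True
      have "\<pi> (w # u) a - \<pi> (v # u') a \<in> pow_image S (Suc n) B \<longleftrightarrow> \<pi> u a - \<pi> u' a \<in> pow_image S n B" for a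
        using True by (auto simp: \<pi>_def image_iff matrix_vector_mult_diff_distrib[symmetric] injS)
      then show ?thesis using True c0 by (simp add: e_def)
    next
      case False
      have "e (Suc n) (w # u) (v # u') \<le> C * measure lborel (pow_image S (Suc n) B)"
        unfolding e_def using that False B by (intro transv compact_pow_image) (auto simp: words_def)
      also have "\<dots> = c" using B by (simp only: measure_pow_image c_def \<delta>_def \<beta>_def)
      finally show ?thesis using False by simp
    qed
    have "E (Suc n) = (\<Sum>w\<in>W. \<Sum>u\<in>words W n. \<Sum>v\<in>W. \<Sum>u'\<in>words W n. e (Suc n) (w # u) (v # u'))"
      by (simp add: E_def sum_words_Suc)
    also have "\<dots> \<le> (\<Sum>w\<in>W. \<Sum>u\<in>words W n. \<Sum>v\<in>W. \<Sum>u'\<in>words W n. (if w = v then e n u u' else 0) + c)"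
      by (intro sum_mono block)
    also have "\<dots> = (\<Sum>w\<in>W. \<Sum>u\<in>words W n. \<Sum>v\<in>W. if w = v then \<Sum>u'\<in>words W n. e n u u' else 0)
        + N * N ^ n * N * N ^ n * c"
    proof -
      have eq: "(\<Sum>u'\<in>words W n. (if w = v then e n u u' else 0) + c)
          = (if w = v then \<Sum>u'\<in>words W n. e n u u' else 0) + N ^ n * c" for w v u
        using finW by (simp add: sum.distrib N_def)
      show ?thesis unfolding eq using finW by (simp add: sum.distrib N_def algebra_simps)
    qed
    also have "(\<Sum>w\<in>W. \<Sum>u\<in>words W n. \<Sum>v\<in>W. if w = v then \<Sum>u'\<in>words W n. e n u u' else 0) = N * E n"
      using finW by (simp add: E_def N_def sum.delta)
    also have "N * N ^ n * N * N ^ n * c = (N\<^sup>2 * \<delta>) ^ Suc n * (C * \<beta>)"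
      by (simp add: c_def power_mult_distrib power2_eq_square algebra_simps)
    finally show ?thesis .
  qed
  have "E n \<le> K * (N\<^sup>2 * \<delta>) ^ n" for n
  proof (induction n)
    case 0
    have "{a \<in> Q. \<pi> [] a - \<pi> [] a \<in> B} \<in> sets borel"
      using Q by (cases "0 \<in> B") (auto simp: \<pi>_def borel_compact)
    then have "measure lborel {a \<in> Q. \<pi> [] a - \<pi> [] a \<in> B} \<le> measure lborel Q"
      using Q by (intro measure_lborel_mono_compact) auto
    then show ?case by (simp add: E_def e_def K_def)
  next
    case (Suc n)
    have "E (Suc n) \<le> N * (K * (N\<^sup>2 * \<delta>) ^ n) + (N\<^sup>2 * \<delta>) ^ Suc n * (C * \<beta>)"
      using rec[of n] mult_left_mono[OF Suc.IH, of N] N0 by linarith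
    also have "N * (K * (N\<^sup>2 * \<delta>) ^ n) = (N\<^sup>2 * \<delta>) ^ Suc n * (K / (N * \<delta>))"
      using N0 \<delta>0 by (simp add: field_simps power2_eq_square)
    also have "\<dots> + (N\<^sup>2 * \<delta>) ^ Suc n * (C * \<beta>) = (N\<^sup>2 * \<delta>) ^ Suc n * (K / (N * \<delta>) + C * \<beta>)"
      by (simp add: algebra_simps)
    also have "\<dots> \<le> (N\<^sup>2 * \<delta>) ^ Suc n * K"
      using K2 N0 \<delta>0 by (intro mult_left_mono) auto
    finally show ?case by (simp add: mult.commute)
  qed
  then show ?thesis by (auto simp: E_def e_def N_def \<delta>_def)
qed

section \<open>Positive measure of the homogeneous attractor\<close>

text \<open>The Cauchy-Schwarz inequality for the counting function \<open>h = \<Sum>\<^sub>i 1\<^sub>E\<^sub>i\<close>, which is supported on the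
  union. It is obtained by integrating \<open>2 t h - h\<^sup>2 \<le> t\<^sup>2\<close> on that support and optimising in \<open>t\<close>.\<close>

lemma second_moment_union:
  assumes "finite I" "\<And>i. i \<in> I \<Longrightarrow> E i \<in> fmeasurable M"
  shows "(\<Sum>i\<in>I. measure M (E i))\<^sup>2 \<le>
    measure M (\<Union>i\<in>I. E i) * (\<Sum>i\<in>I. \<Sum>j\<in>I. measure M (E i \<inter> E j))"
proof -
  let ?U = "\<Union>i\<in>I. E i"
  define s where "s = (\<Sum>i\<in>I. measure M (E i))"
  define J where "J = (\<Sum>i\<in>I. \<Sum>j\<in>I. measure M (E i \<inter> E j))"
  define L where "L = measure M ?U"
  have U: "?U \<in> fmeasurable M" using assms by (intro fmeasurable.finite_UN) auto
  have quad: "2 * t * s - J \<le> t\<^sup>2 * L" for t :: real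
  proof -
    have int: "integrable M (\<lambda>x. indicat_real A x)" if "A \<in> fmeasurable M" for A
      using that by (simp add: fmeasurable_def)
    have mInt: "measure M (A \<inter> space M) = measure M A" if "A \<in> fmeasurable M" for A
      using that fmeasurable.Int_space_eq2 by metis
    have fm: "E i \<inter> E j \<in> fmeasurable M" if "i \<in> I" "j \<in> I" for i j
      using assms that by auto
    have s: "s = (LINT x|M. (\<Sum>i\<in>I. indicat_real (E i) x))"
      unfolding s_def using assms by (subst Bochner_Integration.integral_sum) (auto simp: int mInt)
    have J: "J = (LINT x|M. (\<Sum>i\<in>I. \<Sum>j\<in>I. indicat_real (E i \<inter> E j) x))"
      unfolding J_def using fm assms(1)
      by (subst Bochner_Integration.integral_sum)
         (auto simp: int mInt intro!: sum.cong Bochner_Integration.integral_sum[symmetric])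
    have "2 * t * s - J = (LINT x|M. 2 * t * (\<Sum>i\<in>I. indicat_real (E i) x)
        - (\<Sum>i\<in>I. \<Sum>j\<in>I. indicat_real (E i \<inter> E j) x))"
      unfolding s J using assms fm by (subst Bochner_Integration.integral_diff) (auto simp: int)
    also have "\<dots> \<le> (LINT x|M. t\<^sup>2 * indicat_real ?U x)"
    proof (rule integral_mono)
      fix x
      define h where "h = (\<Sum>i\<in>I. indicat_real (E i) x)"
      have hh: "(\<Sum>i\<in>I. \<Sum>j\<in>I. indicat_real (E i \<inter> E j) x) = h * h"
        unfolding h_def by (simp add: sum_product indicator_inter_arith)
      show "2 * t * (\<Sum>i\<in>I. indicat_real (E i) x)
          - (\<Sum>i\<in>I. \<Sum>j\<in>I. indicat_real (E i \<inter> E j) x) \<le> t\<^sup>2 * indicat_real ?U x"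
      proof (cases "x \<in> ?U")
        case True
        have "0 \<le> (t - h)\<^sup>2" by simp
        then show ?thesis using True unfolding hh h_def[symmetric]
          by (simp add: power2_eq_square algebra_simps)
      next
        case False
        then have "h = 0" by (auto simp: h_def indicator_def intro!: sum.neutral)
        then show ?thesis unfolding hh h_def[symmetric] by simp
      qed
    qed (use assms fm U in \<open>auto simp: int\<close>)
    also have "\<dots> = t\<^sup>2 * L" using U by (simp add: L_def mInt)
    finally show ?thesis .
  qed
  have nonneg: "0 \<le> s" "0 \<le> J" "0 \<le> L"
    unfolding s_def J_def L_def by (auto intro!: sum_nonneg)
  have "s\<^sup>2 \<le> L * J"
  proof (cases "s = 0")
    case False
    then have spos: "s > 0" using nonneg by simp
    \<comment> \<open>If \<open>h\<close> is constant on the union, its value there is \<open>J / s\<close>, and this choice of \<open>t\<close> loses nothing.\<close>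
    have "2 * (J / s) * s - J \<le> (J / s)\<^sup>2 * L" by (rule quad)
    then have "J * s\<^sup>2 \<le> J\<^sup>2 * L" using spos by (simp add: field_simps power2_eq_square)
    moreover have "J > 0"
    proof (rule ccontr)
      assume "\<not> J > 0"
      then have J0: "J = 0" using nonneg by simp
      have q: "2 * t * s \<le> t\<^sup>2 * L" for t using quad[of t] J0 by simp
      \<comment> \<open>With \<open>J = 0\<close> the quadratic inequality fails for small \<open>t\<close>.\<close>
      define t where "t = s / (L + 1)"
      have ts: "t * (L + 1) = s" "t > 0" using spos nonneg(3) by (auto simp: t_def)
      have "t * (2 * s) \<le> t * (t * L)" using q[of t] by (simp add: power2_eq_square algebra_simps)
      then have "2 * s \<le> t * L" using ts(2) by (simp only: mult_le_cancel_left_pos)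
      then show False using ts spos by (simp add: algebra_simps)
    qed
    ultimately show ?thesis by (simp add: power2_eq_square mult.commute)
  qed (use nonneg in auto)
  then show ?thesis by (simp add: s_def J_def L_def)
qed

text \<open>The level-\<open>n\<close> approximation of the attractor of \<open>x \<mapsto> S x + b w a\<close>: the union of the images of the
  ball of radius \<open>R\<close> under all compositions of \<open>n\<close> maps.\<close>

definition cylinder_cover ::
    "'w set \<Rightarrow> real^'d^'d \<Rightarrow> ('w \<Rightarrow> 'p \<Rightarrow> real^'d) \<Rightarrow> real \<Rightarrow> 'p \<Rightarrow> nat \<Rightarrow> (real^'d) set" where
  "cylinder_cover W S b R a n =
    (\<Union>u\<in>words W n. (+) (code_point (\<lambda>_. S) b u a) ` pow_image S n (cball 0 R))"

lemma cylinder_cover_Suc: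
  "cylinder_cover W S b R a (Suc n) = (\<Union>w\<in>W. (\<lambda>x. b w a + S *v x) ` cylinder_cover W S b R a n)"
proof -
  have eq: "(+) (code_point (\<lambda>_. S) b (w # u) a) ` pow_image S (Suc n) (cball 0 R)
      = (\<lambda>x. b w a + S *v x) ` (+) (code_point (\<lambda>_. S) b u a) ` pow_image S n (cball 0 R)" for w u
    by (simp add: image_image matrix_vector_right_distrib add.assoc)
  have "cylinder_cover W S b R a (Suc n) =
      (\<Union>w\<in>W. \<Union>u\<in>words W n. (+) (code_point (\<lambda>_. S) b (w # u) a) ` pow_image S (Suc n) (cball 0 R))"
    unfolding cylinder_cover_def words_Suc by (auto simp del: code_point.simps funpow.simps)
  also have "\<dots> = (\<Union>w\<in>W. (\<lambda>x. b w a + S *v x) ` cylinder_cover W S b R a n)"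
    by (simp only: eq image_UN cylinder_cover_def)
  finally show ?thesis .
qed

lemma compact_cylinder_cover: "finite W \<Longrightarrow> compact (cylinder_cover W S b R a n)"
  unfolding cylinder_cover_def
  by (intro compact_UN) (auto intro!: compact_translation compact_pow_image)

lemma decseq_cylinder_cover:
  assumes "\<And>w x. w \<in> W \<Longrightarrow> norm x \<le> R \<Longrightarrow> norm (b w a + S *v x) \<le> R"
  shows "decseq (cylinder_cover W S b R a)"
proof (rule decseq_SucI)
  fix n show "cylinder_cover W S b R a (Suc n) \<subseteq> cylinder_cover W S b R a n"
  proof (induction n)
    case 0
    have "cylinder_cover W S b R a 0 = cball 0 R" by (simp add: cylinder_cover_def)
    then show ?case using assms by (auto simp: cylinder_cover_Suc)
  next
    case (Suc n)
    then show ?case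
      by (subst cylinder_cover_Suc, subst (2) cylinder_cover_Suc) (intro UN_mono image_mono order_refl)
  qed
qed

lemma frequently_less_of_liminf:
  fixes X :: "nat \<Rightarrow> ennreal"
  assumes "liminf X \<noteq> \<infinity>"
  obtains c where "0 < c" "frequently (\<lambda>n. X n < ennreal c) sequentially"
proof -
  obtain c where c: "liminf X < c" "c < \<infinity>"
    using assms dense[of "liminf X" \<infinity>] by (auto simp: less_top)
  have "frequently (\<lambda>n. X n < c) sequentially"
  proof (rule ccontr)
    assume "\<not> ?thesis"
    then have "eventually (\<lambda>n. c \<le> X n) sequentially" by (simp add: not_frequently not_less)
    then have "c \<le> liminf X" by (rule Liminf_bounded)
    then show False using c(1) by simp
  qed
  moreover obtain r where "c = ennreal r" "0 \<le> r" using c(2) by (cases c rule: ennreal_cases) auto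
  ultimately have r: "frequently (\<lambda>n. X n < ennreal r) sequentially" "0 \<le> r" by auto
  then have "r \<noteq> 0" by auto
  then show thesis using that[of r] r by simp
qed

text \<open>The second moment inequality for the cylinders of level \<open>n\<close>. All of them have the same measure, and
  two of them can meet only if the difference of their base points lies in the image of the doubled
  ball.\<close>

lemma measure_cylinder_cover_ge:
  fixes S :: "real^'d^'d" and b :: "'w \<Rightarrow> 'p \<Rightarrow> real^'d"
  defines "\<pi> \<equiv> code_point (\<lambda>_. S) b"
  assumes finW: "finite W" and ne: "W \<noteq> {}" and inv: "invertible S" and R: "0 < R" and c: "0 < c"
    and few: "(\<Sum>u\<in>words W n. \<Sum>v\<in>words W n.
        indicat_real {a. \<pi> u a - \<pi> v a \<in> pow_image S n (cball 0 (R + R))} a)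
      \<le> c * ((real (card W))\<^sup>2 * \<bar>det S\<bar>) ^ n"
  shows "measure lborel (cball (0::real^'d) R) / c \<le> measure lborel (cylinder_cover W S b R a n)"
proof -
  define N where "N = real (card W)"
  define \<delta> where "\<delta> = \<bar>det S\<bar>"
  define \<beta> where "\<beta> = measure lborel (cball (0::real^'d) R)"
  define E where "E = (\<lambda>u. (+) (\<pi> u a) ` pow_image S n (cball 0 R))"
  define L where "L = measure lborel (cylinder_cover W S b R a n)"
  have pos: "0 < N" "0 < \<delta>" "0 < \<beta>"
    using finW ne inv R by (auto simp: N_def \<delta>_def \<beta>_def card_gt_0_iff invertible_det_nz content_cball)
  have cE: "compact (E u)" for u
    unfolding E_def by (intro compact_translation compact_pow_image) auto
  have mE: "measure lborel (E u) = \<delta> ^ n * \<beta>" for u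
    unfolding E_def by (subst measure_translate_compact) (simp_all add: compact_pow_image measure_pow_image \<delta>_def \<beta>_def)
  have meet: "measure lborel (E u \<inter> E v)
      \<le> (\<delta> ^ n * \<beta>) * indicat_real {a. \<pi> u a - \<pi> v a \<in> pow_image S n (cball 0 (R + R))} a" for u v
  proof (cases "E u \<inter> E v = {}")
    case False
    then obtain p q where pq: "p \<in> pow_image S n (cball 0 R)" "q \<in> pow_image S n (cball 0 R)"
      "\<pi> u a + p = \<pi> v a + q" by (auto simp: E_def)
    then have "\<pi> u a - \<pi> v a = q - p" by (simp add: algebra_simps)
    then have "\<pi> u a - \<pi> v a \<in> pow_image S n (cball 0 (R + R))" using pow_image_diff pq by metis
    moreover have "measure lborel (E u \<inter> E v) \<le> measure lborel (E u)"
      using cE by (intro measure_lborel_mono_compact) (auto simp: borel_compact)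
    ultimately show ?thesis by (simp add: mE)
  qed (use pos in simp)
  have "(\<Sum>u\<in>words W n. \<Sum>v\<in>words W n. measure lborel (E u \<inter> E v))
      \<le> (\<Sum>u\<in>words W n. \<Sum>v\<in>words W n. (\<delta> ^ n * \<beta>) *
          indicat_real {a. \<pi> u a - \<pi> v a \<in> pow_image S n (cball 0 (R + R))} a)"
    by (intro sum_mono meet)
  also have "\<dots> \<le> (\<delta> ^ n * \<beta>) * (c * (N\<^sup>2 * \<delta>) ^ n)"
    using few pos unfolding sum_distrib_left[symmetric] N_def \<delta>_def
    by (intro mult_left_mono) auto
  finally have J: "(\<Sum>u\<in>words W n. \<Sum>v\<in>words W n. measure lborel (E u \<inter> E v))
      \<le> (\<delta> ^ n * \<beta>) * (c * (N\<^sup>2 * \<delta>) ^ n)" .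
  have "(N ^ n * (\<delta> ^ n * \<beta>))\<^sup>2 = (\<Sum>u\<in>words W n. measure lborel (E u))\<^sup>2"
    using finW by (simp add: mE N_def)
  also have "\<dots> \<le> measure lborel (\<Union>u\<in>words W n. E u) *
      (\<Sum>u\<in>words W n. \<Sum>v\<in>words W n. measure lborel (E u \<inter> E v))"
    using finW cE by (intro second_moment_union) (auto intro: fmeasurable_compact)
  also have "(\<Union>u\<in>words W n. E u) = cylinder_cover W S b R a n"
    by (simp add: cylinder_cover_def E_def \<pi>_def)
  also have "measure lborel \<dots> * (\<Sum>u\<in>words W n. \<Sum>v\<in>words W n. measure lborel (E u \<inter> E v))
      \<le> L * ((\<delta> ^ n * \<beta>) * (c * (N\<^sup>2 * \<delta>) ^ n))"
    unfolding L_def by (intro mult_left_mono J) auto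
  finally have "(N ^ n * (\<delta> ^ n * \<beta>))\<^sup>2 \<le> L * ((\<delta> ^ n * \<beta>) * (c * (N\<^sup>2 * \<delta>) ^ n))" .
  moreover have "(N ^ n * (\<delta> ^ n * \<beta>))\<^sup>2 = ((N ^ n)\<^sup>2 * (\<delta> ^ n)\<^sup>2 * \<beta>) * \<beta>"
    by (simp add: power2_eq_square algebra_simps)
  moreover have "L * ((\<delta> ^ n * \<beta>) * (c * (N\<^sup>2 * \<delta>) ^ n)) = ((N ^ n)\<^sup>2 * (\<delta> ^ n)\<^sup>2 * \<beta>) * (L * c)"
    by (simp add: power2_eq_square power_mult_distrib algebra_simps)
  moreover have "0 < (N ^ n)\<^sup>2 * (\<delta> ^ n)\<^sup>2 * \<beta>" using pos by simp
  ultimately have "\<beta> \<le> L * c" by (metis mult_le_cancel_left_pos)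
  then show ?thesis using c by (simp add: L_def \<beta>_def field_simps)
qed

text \<open>The normalised number of meeting pairs has bounded mean, so by Fatou's lemma its lower limit is
  finite for almost every parameter. Along a subsequence the cylinder covers then have measure bounded
  below; as they decrease, the bound passes to their intersection.\<close>

lemma AE_positive_measure_attractor:
  fixes S :: "real^'d^'d" and b :: "'w \<Rightarrow> 'p::euclidean_space \<Rightarrow> real^'d"
  defines "\<pi> \<equiv> code_point (\<lambda>_. S) b"
  assumes finW: "finite W" and cont: "\<And>w. w \<in> W \<Longrightarrow> continuous_on UNIV (b w)"
    and inv: "invertible S" and big: "1 < real (card W) * \<bar>det S\<bar>"
    and Q: "compact Q" and C: "0 \<le> C" and R: "0 < R"
    and transv: "\<And>w v u u' X. \<lbrakk>w \<in> W; v \<in> W; w \<noteq> v; set u \<subseteq> W; set u' \<subseteq> W; compact X\<rbrakk> \<Longrightarrow>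
      measure lborel {a \<in> Q. \<pi> (w # u) a - \<pi> (v # u') a \<in> X} \<le> C * measure lborel X"
    and stable: "\<And>a w x. a \<in> Q \<Longrightarrow> w \<in> W \<Longrightarrow> norm x \<le> R \<Longrightarrow> norm (b w a + S *v x) \<le> R"
  shows "AE a in lborel. a \<in> Q \<longrightarrow> 0 < measure lborel (\<Inter>n. cylinder_cover W S b R a n)"
proof -
  define M where "M = (real (card W))\<^sup>2 * \<bar>det S\<bar>"
  define B where "B = cball (0::real^'d) (R + R)"
  define Y where "Y = (\<lambda>n u v. {a \<in> Q. \<pi> u a - \<pi> v a \<in> pow_image S n B})"
  define g where "g = (\<lambda>n a. ennreal ((\<Sum>u\<in>words W n. \<Sum>v\<in>words W n. indicat_real (Y n u v) a) / M ^ n))"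
  have cB: "compact B" by (simp add: B_def)
  have ne: "W \<noteq> {}" using big by auto
  have M0: "0 < M" using finW ne inv by (simp add: M_def card_gt_0_iff invertible_det_nz)
  have cY: "compact (Y n u v)" if "u \<in> words W n" "v \<in> words W n" for n u v
    unfolding Y_def using that cont Q compact_pow_image[OF cB]
    by (intro compact_preimage_in_compact continuous_on_diff) (auto simp: \<pi>_def words_def intro!: continuous_code_point[where W = W])
  obtain K where K: "\<And>n. (\<Sum>u\<in>words W n. \<Sum>v\<in>words W n. measure lborel (Y n u v)) \<le> K * M ^ n"
    using pair_energy_bound[OF finW cont inv big Q cB C transv[unfolded \<pi>_def]]
    unfolding M_def Y_def \<pi>_def by blast
  have int: "integrable lborel (indicat_real (Y n u v))" if "u \<in> words W n" "v \<in> words W n" for n u v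
    using cY[OF that] by (intro integrable_real_indicator) (simp_all add: borel_compact emeasure_compact_eq)
  have gm: "g n \<in> borel_measurable lborel" for n
    unfolding g_def using int
    by (intro measurable_compose[OF _ measurable_ennreal] borel_measurable_divide borel_measurable_sum)
       (auto intro: borel_measurable_integrable)
  have gint: "(\<integral>\<^sup>+ a. g n a \<partial>lborel) \<le> ennreal K" for n
  proof -
    have "(\<integral>\<^sup>+ a. g n a \<partial>lborel) =
        ennreal (LINT a|lborel. (\<Sum>u\<in>words W n. \<Sum>v\<in>words W n. indicat_real (Y n u v) a) / M ^ n)"
      unfolding g_def using int M0
      by (intro nn_integral_eq_integral) (auto intro!: integrable_sum integrable_divide sum_nonneg divide_nonneg_pos)
    also have "(LINT a|lborel. (\<Sum>u\<in>words W n. \<Sum>v\<in>words W n. indicat_real (Y n u v) a) / M ^ n) =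
        (\<Sum>u\<in>words W n. \<Sum>v\<in>words W n. measure lborel (Y n u v)) / M ^ n"
      using int by (simp add: Bochner_Integration.integral_sum integrable_sum)
    also have "\<dots> \<le> K" using K[of n] M0 by (simp add: pos_divide_le_eq)
    finally show ?thesis by (simp add: ennreal_leI)
  qed
  have "(\<integral>\<^sup>+ a. liminf (\<lambda>n. g n a) \<partial>lborel) \<le> liminf (\<lambda>n. \<integral>\<^sup>+ a. g n a \<partial>lborel)"
    by (rule nn_integral_liminf[OF gm])
  also have "\<dots> \<le> limsup (\<lambda>n. \<integral>\<^sup>+ a. g n a \<partial>lborel)" by (rule Liminf_le_Limsup) simp
  also have "\<dots> \<le> ennreal K" using gint by (intro Limsup_bounded) auto
  finally have "(\<integral>\<^sup>+ a. liminf (\<lambda>n. g n a) \<partial>lborel) \<noteq> \<infinity>" by (auto simp: top_unique)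
  then have "AE a in lborel. liminf (\<lambda>n. g n a) \<noteq> \<infinity>"
    using gm by (intro nn_integral_PInf_AE) auto
  then show ?thesis
  proof (rule AE_mp, intro AE_I2 impI)
    fix a assume fin: "liminf (\<lambda>n. g n a) \<noteq> \<infinity>" and a: "a \<in> Q"
    let ?A = "cylinder_cover W S b R a"
    obtain c where c: "0 < c" "frequently (\<lambda>n. g n a < ennreal c) sequentially"
      using frequently_less_of_liminf[OF fin] by blast
    define l where "l = measure lborel (cball (0::real^'d) R) / c"
    have l0: "0 < l" using c(1) R by (simp add: l_def content_cball)
    have often: "frequently (\<lambda>n. l \<le> measure lborel (?A n)) sequentially"
      using c(2)
    proof (rule frequently_elim1)
      fix n assume "g n a < ennreal c"
      then have "(\<Sum>u\<in>words W n. \<Sum>v\<in>words W n. indicat_real (Y n u v) a) / M ^ n < c"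
        unfolding g_def using M0 by (subst (asm) ennreal_less_iff) (auto intro!: divide_nonneg_pos sum_nonneg)
      then have "(\<Sum>u\<in>words W n. \<Sum>v\<in>words W n. indicat_real (Y n u v) a) \<le> c * M ^ n"
        using M0 by (simp add: pos_divide_less_eq)
      moreover have "indicat_real (Y n u v) a
          = indicat_real {a. \<pi> u a - \<pi> v a \<in> pow_image S n (cball 0 (R + R))} a" for u v
        using a by (simp add: Y_def B_def indicator_def)
      ultimately show "l \<le> measure lborel (?A n)"
        unfolding l_def using finW ne inv R c(1)
        by (intro measure_cylinder_cover_ge) (auto simp: M_def \<pi>_def)
    qed
    have dec: "decseq ?A" using stable a by (intro decseq_cylinder_cover) auto
    have cA: "compact (?A n)" for n using finW by (rule compact_cylinder_cover)
    have ge: "l \<le> measure lborel (?A n)" for n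
    proof -
      obtain k where k: "n \<le> k" "l \<le> measure lborel (?A k)"
        using often by (auto simp: frequently_sequentially)
      moreover have "measure lborel (?A k) \<le> measure lborel (?A n)"
        using dec k(1) cA by (intro measure_lborel_mono_compact) (auto simp: decseq_def borel_compact)
      ultimately show ?thesis by linarith
    qed
    have "(\<lambda>n. measure lborel (?A n)) \<longlonglongrightarrow> measure lborel (\<Inter>n. ?A n)"
      using dec cA
      by (intro Lim_measure_decseq) (auto simp: borel_compact emeasure_compact_eq)
    then have "l \<le> measure lborel (\<Inter>n. ?A n)" using ge by (intro LIMSEQ_le_const) auto
    then show "0 < measure lborel (\<Inter>n. ?A n)" using l0 by linarith
  qed
qed

section \<open>The self-affine set as the invariant compact set\<close>

text \<open>Follow an address of \<open>x\<close> in \<open>K\<close> to depth \<open>n\<close> but end it at a point of \<open>L\<close>; the result is in \<open>L\<close>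
  and within distance \<open>t\<^sup>n d\<close> of \<open>x\<close>. Applied both ways this gives uniqueness of the invariant compact set.\<close>

lemma invariant_subset_invariant:
  fixes f :: "'i \<Rightarrow> 'a::metric_space \<Rightarrow> 'a"
  assumes contr: "\<And>i x y. dist (f i x) (f i y) \<le> t * dist x y" and t: "0 \<le> t" "t < 1"
    and K: "compact K" "K \<subseteq> (\<Union>i. f i ` K)"
    and L: "compact L" "L \<noteq> {}" "\<And>i. f i ` L \<subseteq> L"
  shows "K \<subseteq> L"
proof
  fix x assume x: "x \<in> K"
  obtain y0 where y0: "y0 \<in> L" using L(2) by blast
  obtain d where d: "\<And>y. y \<in> K \<Longrightarrow> dist y y0 \<le> d"
    using compact_imp_bounded[OF K(1)] unfolding bounded_any_center[of _ y0] by (metis dist_commute)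
  have near: "\<exists>y\<in>L. dist x y \<le> t ^ n * d" if "x \<in> K" for x n
    using that
  proof (induction n arbitrary: x)
    case 0
    then show ?case using d y0 by auto
  next
    case (Suc n)
    then obtain i x' where x': "x' \<in> K" "x = f i x'" using K(2) by blast
    then obtain y where y: "y \<in> L" "dist x' y \<le> t ^ n * d" using Suc.IH by blast
    have "dist x (f i y) \<le> t * dist x' y" using contr x' by simp
    also have "\<dots> \<le> t * (t ^ n * d)" using y t by (intro mult_left_mono) auto
    finally show ?case using L(3)[of i] y(1) by (intro bexI[of _ "f i y"]) (auto simp: mult.assoc)
  qed
  have "x \<in> closure L"
    unfolding closure_approachable
  proof (intro allI impI)
    fix e :: real assume "0 < e"
    have "(\<lambda>n. t ^ n * d) \<longlonglongrightarrow> 0 * d" using t by (intro tendsto_intros LIMSEQ_power_zero) auto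
    then have "eventually (\<lambda>n. t ^ n * d < e) sequentially" using \<open>0 < e\<close> by (simp add: order_tendstoD)
    then obtain n where "t ^ n * d < e" by (auto simp: eventually_sequentially)
    moreover obtain y where "y \<in> L" "dist x y \<le> t ^ n * d" using near[OF x] by blast
    ultimately show "\<exists>y\<in>L. dist y x < e" by (metis dist_commute le_less_trans)
  qed
  then show "x \<in> L" using L(1) by (simp add: compact_imp_closed closure_closed)
qed

text \<open>The invariant set is the intersection of the decreasing iterates of \<open>B\<close>. A point of it lies, for
  every \<open>n\<close>, in the image of the \<open>n\<close>-th iterate under some map; one map serves infinitely many \<open>n\<close>, hence all
  \<open>n\<close>, and injectivity lets its image commute with the intersection.\<close>

lemma invariant_set_exists:
  fixes f :: "'i::finite \<Rightarrow> 'a::euclidean_space \<Rightarrow> 'a"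
  assumes cont: "\<And>i. continuous_on UNIV (f i)" and inj: "\<And>i. inj (f i)"
    and B: "compact B" "B \<noteq> {}" "\<And>i. f i ` B \<subseteq> B"
  shows "\<exists>K. K \<noteq> {} \<and> compact K \<and> K = (\<Union>i. f i ` K)"
proof -
  define F where "F = (\<lambda>X. \<Union>i. f i ` X)"
  define G where "G = (\<lambda>n. (F ^^ n) B)"
  define K where "K = (\<Inter>n. G n)"
  have GSuc: "G (Suc n) = (\<Union>i. f i ` G n)" for n by (simp add: G_def F_def)
  have cG: "compact (G n)" for n
  proof (induction n)
    case (Suc n)
    then show ?case unfolding GSuc using cont
      by (intro compact_UN compact_continuous_image) (auto intro: continuous_on_subset)
  qed (use B in \<open>simp add: G_def\<close>)
  have neG: "G n \<noteq> {}" for n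
    by (induction n) (use B in \<open>auto simp: GSuc, simp add: G_def\<close>)
  have "G (Suc n) \<subseteq> G n" for n
  proof (induction n)
    case 0
    then show ?case using B by (auto simp: G_def F_def)
  next
    case (Suc n)
    then show ?case by (subst (1 2) GSuc) (intro UN_mono image_mono order_refl)
  qed
  then have dec: "m \<le> n \<Longrightarrow> G n \<subseteq> G m" for m n by (rule lift_Suc_antimono_le)
  have "K \<noteq> {}" unfolding K_def using cG neG dec by (intro compact_nest)
  moreover have "compact K" unfolding K_def using cG by (intro compact_Inter) auto
  moreover have "(\<Union>i. f i ` K) \<subseteq> K"
  proof
    fix x assume "x \<in> (\<Union>i. f i ` K)"
    then have "x \<in> G (Suc n)" for n unfolding GSuc K_def by blast
    then show "x \<in> K" unfolding K_def using dec[of _ "Suc _"] by (metis INT_I le_Suc_eq order_refl subsetD)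
  qed
  moreover have "K \<subseteq> (\<Union>i. f i ` K)"
  proof
    fix x assume "x \<in> K"
    then have "\<forall>n. \<exists>i. x \<in> f i ` G n" unfolding K_def using GSuc by blast
    then obtain i where i: "\<And>n. x \<in> f (i n) ` G n" by metis
    obtain k where "infinite {n. i n = i k}"
      using pigeonhole_infinite[of "UNIV :: nat set" i] by auto
    have "x \<in> f (i k) ` G n" for n
    proof -
      obtain m where "m \<ge> n" "i m = i k"
        using \<open>infinite {n. i n = i k}\<close> unfolding infinite_nat_iff_unbounded_le by blast
      then show ?thesis using i[of m] dec[of n m] by auto
    qed
    then have "x \<in> (\<Inter>n. f (i k) ` G n)" by blast
    also have "\<dots> = f (i k) ` K"
      unfolding K_def using inj[of "i k"] by (intro image_INT[symmetric]) (auto simp: inj_on_def)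
    finally show "x \<in> (\<Union>i. f i ` K)" by blast
  qed
  ultimately show ?thesis by blast
qed

lemma self_affine_set_props:
  fixes T :: "'m::finite \<Rightarrow> real^'d^'d"
  assumes inv: "\<And>i. invertible (T i)" and t: "0 \<le> t" "t < 1"
    and contr: "\<And>i x. norm (T i *v x) \<le> t * norm x"
  shows "self_affine_set T a \<noteq> {}" "compact (self_affine_set T a)"
    and "\<And>i x. x \<in> self_affine_set T a \<Longrightarrow> T i *v x + a $ i \<in> self_affine_set T a"
proof -
  define f where "f = (\<lambda>i x. T i *v x + a $ i)"
  let ?P = "\<lambda>K. K \<noteq> {} \<and> compact K \<and> K = (\<Union>i. f i ` K)"
  define R where "R = norm a / (1 - t)"
  have R: "0 \<le> R" "t * R + norm a = R" using t by (auto simp: R_def field_simps)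
  have "\<exists>K. ?P K"
  proof (rule invariant_set_exists)
    show "continuous_on UNIV (f i)" for i
      unfolding f_def by (intro continuous_intros matrix_vector_mult_linear_continuous_on)
    show "inj (f i)" for i
      using inj_matrix_vector_mult[OF inv[of i]] by (auto simp: f_def inj_def)
    show "f i ` cball 0 R \<subseteq> cball 0 R" for i
    proof
      fix y assume "y \<in> f i ` cball 0 R"
      then obtain x where x: "norm x \<le> R" "y = T i *v x + a $ i" by (auto simp: f_def)
      have "norm y \<le> t * norm x + norm a"
        using norm_triangle_ineq[of "T i *v x" "a $ i"] contr[of i x] Finite_Cartesian_Product.norm_nth_le[of a i] x(2) by simp
      also have "\<dots> \<le> R" using mult_left_mono[OF x(1) t(1)] R(2) by linarith
      finally show "y \<in> cball 0 R" by simp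
    qed
  qed (use R in auto)
  then have "\<exists>!K. ?P K"
  proof (rule ex_ex1I)
    fix K L assume KL: "?P K" "?P L"
    have con: "dist (f i x) (f i y) \<le> t * dist x y" for i x y
      using contr[of i "x - y"] by (simp add: f_def dist_norm matrix_vector_mult_diff_distrib)
    have "K \<subseteq> L" if "?P K" "?P L" for K L
    proof (rule invariant_subset_invariant[of f t])
      have K: "K = (\<Union>i. f i ` K)" using that(1) by (elim conjE)
      have L: "L = (\<Union>i. f i ` L)" using that(2) by (elim conjE)
      show "K \<subseteq> (\<Union>i. f i ` K)" by (subst K) (rule order_refl)
      show "f i ` L \<subseteq> L" for i by (subst (2) L) (rule UN_upper, rule UNIV_I)
      show "compact K" using that(1) by (elim conjE)
      show "compact L" using that(2) by (elim conjE)
      show "L \<noteq> {}" using that(2) by (elim conjE)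
    qed (rule con t)+
    from this[OF KL] this[OF KL(2,1)] show "K = L" by (rule subset_antisym)
  qed
  from theI'[OF this] have P: "?P (self_affine_set T a)"
    unfolding self_affine_set_def f_def .
  show "self_affine_set T a \<noteq> {}" using P by (elim conjE)
  show "compact (self_affine_set T a)" using P by (elim conjE)
  fix i x assume "x \<in> self_affine_set T a"
  then have "T i *v x + a $ i \<in> (\<Union>i. f i ` self_affine_set T a)" by (auto simp: f_def)
  also have "\<dots> = self_affine_set T a" using P[THEN conjunct2, THEN conjunct2] by (rule sym)
  finally show "T i *v x + a $ i \<in> self_affine_set T a" .
qed

section \<open>A large class of words with a common matrix\<close>

primrec word_matrix :: "('i \<Rightarrow> real^'d^'d) \<Rightarrow> 'i list \<Rightarrow> real^'d^'d" where
  "word_matrix T [] = mat 1"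
| "word_matrix T (i # w) = T i ** word_matrix T w"

lemma word_matrix_append: "word_matrix T (p @ q) = word_matrix T p ** word_matrix T q"
  by (induction p) (auto simp: matrix_mul_assoc)

lemma word_matrix_cong_mset:
  assumes comm: "\<And>i j. T i ** T j = T j ** T i" and "mset w = mset v"
  shows "word_matrix T w = word_matrix T v"
proof -
  have "word_matrix T w = fold (\<lambda>i M. T i ** M) w (mat 1)" for w
  proof -
    have "word_matrix T w = foldr (\<lambda>i M. T i ** M) w (mat 1)" by (induction w) auto
    also have "foldr (\<lambda>i M. T i ** M) w = fold (\<lambda>i M. T i ** M) w"
      by (rule foldr_fold) (auto simp: fun_eq_iff matrix_mul_assoc comm)
    finally show ?thesis .
  qed
  moreover have "fold (\<lambda>i M. T i ** M) w = fold (\<lambda>i M. T i ** M) v"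
    using assms(2) by (intro fold_multiset_equiv) (auto simp: fun_eq_iff matrix_mul_assoc comm)
  ultimately show ?thesis by metis
qed

lemma sum_words_det_square:
  fixes T :: "'m::finite \<Rightarrow> real^'d^'d"
  shows "(\<Sum>w\<in>words UNIV n. (det (word_matrix T w))\<^sup>2) = (\<Sum>i\<in>UNIV. (det (T i))\<^sup>2) ^ n"
proof (induction n)
  case (Suc n)
  have "(\<Sum>w\<in>words UNIV (Suc n). (det (word_matrix T w))\<^sup>2)
      = (\<Sum>i\<in>UNIV. (det (T i))\<^sup>2 * (\<Sum>w\<in>words UNIV n. (det (word_matrix T w))\<^sup>2))"
    by (simp add: sum_words_Suc det_mul power_mult_distrib sum_distrib_left)
  then show ?case by (simp add: Suc sum_distrib_right)
qed simp

lemma exists_poly_less_power: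
  fixes s :: real assumes "1 < s"
  shows "\<exists>n\<ge>1. real ((n + 1) ^ m) < s ^ n"
proof -
  have "eventually (\<lambda>n :: nat. 1 \<le> n \<and> (real n + 1) ^ m < s ^ n) sequentially"
  proof -
    define c where "c = ln s"
    have c: "0 < c" using assms by (simp add: c_def)
    have "filterlim (\<lambda>n :: nat. c * real (n + 1)) at_top sequentially"
      using c by (intro filterlim_tendsto_pos_mult_at_top[OF tendsto_const]
          filterlim_compose[OF filterlim_real_sequentially] filterlim_add_const_nat_at_top) auto
    then have "(\<lambda>n :: nat. (c * real (n + 1)) ^ m / exp (c * real (n + 1))) \<longlonglongrightarrow> 0"
      by (rule filterlim_compose[OF tendsto_power_div_exp_0])
    then have "eventually (\<lambda>n :: nat. (c * real (n + 1)) ^ m / exp (c * real (n + 1)) < c ^ m / s) sequentially"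
      using c assms by (intro order_tendstoD(2)) auto
    then show ?thesis
      using eventually_ge_at_top[of 1]
    proof eventually_elim
      case (elim n)
      have "exp (c * real (n + 1)) = s ^ n * s"
        using assms by (simp add: c_def exp_of_nat2_mult[symmetric] exp_add algebra_simps exp_of_nat_mult)
      then have "c ^ m * ((real n + 1) ^ m / (s ^ n * s)) < c ^ m * (1 / s)"
        using elim(1) by (simp add: power_mult_distrib add.commute)
      then have "(real n + 1) ^ m / (s ^ n * s) < 1 / s"
        using c by (simp only: mult_less_cancel_left_pos zero_less_power)
      then show ?case using elim(2) assms by (simp add: field_simps)
    qed
  qed
  then show ?thesis by (auto simp: eventually_sequentially add.commute)
qed

text \<open>Pigeonhole: if every class of words with a common matrix contributed at most \<open>1\<close> to the sum of
  \<open>(det T\<^sub>w)\<^sup>2\<close>, this exponentially growing sum would be at most the number of letter counts, which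
  is polynomial in \<open>n\<close>.\<close>

lemma exists_large_homogeneous_class:
  fixes T :: "'m::finite \<Rightarrow> real^'d^'d"
  assumes comm: "\<And>i j. T i ** T j = T j ** T i" and big: "1 < (\<Sum>i\<in>UNIV. (det (T i))\<^sup>2)"
  obtains n D where "1 \<le> n" "1 < real (card {w \<in> words UNIV n. word_matrix T w = D}) * (det D)\<^sup>2"
proof -
  define s where "s = (\<Sum>i\<in>UNIV. (det (T i))\<^sup>2)"
  obtain n where n: "1 \<le> n" "real ((n + 1) ^ CARD('m)) < s ^ n"
    using exists_poly_less_power[of s "CARD('m)"] big by (auto simp: s_def)
  let ?V = "words (UNIV :: 'm set) n"
  let ?C = "\<lambda>D. {w \<in> ?V. word_matrix T w = D}"
  let ?types = "PiE (UNIV :: 'm set) (\<lambda>_. {..n})"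
  let ?G = "word_matrix T ` ?V"
  have "card ?G \<le> card ((\<lambda>w. count (mset w)) ` ?V)"
  proof (rule card_le_if_inj_on_rel[where r = "\<lambda>D c. \<exists>w\<in>?V. D = word_matrix T w \<and> c = count (mset w)"])
    fix D D' c
    assume "\<exists>w\<in>?V. D = word_matrix T w \<and> c = count (mset w)"
      "\<exists>w\<in>?V. D' = word_matrix T w \<and> c = count (mset w)"
    then obtain w w' where w: "D = word_matrix T w" "D' = word_matrix T w'"
      "count (mset w) = count (mset w')" by auto
    then have "mset w = mset w'" by (simp only: multiset_eq_iff) simp
    then show "D = D'" using word_matrix_cong_mset[OF comm, of w w'] w by simp
  qed auto
  also have "\<dots> \<le> card ?types"
  proof (rule card_mono)
    show "(\<lambda>w. count (mset w)) ` ?V \<subseteq> ?types"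
      by (auto simp: words_def) (metis count_le_size size_mset)
  qed (auto intro: finite_PiE)
  also have "\<dots> = (n + 1) ^ CARD('m)" by (simp add: card_PiE)
  finally have G: "card ?G \<le> (n + 1) ^ CARD('m)" .
  have "\<exists>D\<in>?G. 1 < real (card (?C D)) * (det D)\<^sup>2"
  proof (rule ccontr)
    assume "\<not> ?thesis"
    then have le: "real (card (?C D)) * (det D)\<^sup>2 \<le> 1" if "D \<in> ?G" for D
      using that by (meson not_le)
    have "s ^ n = (\<Sum>w\<in>?V. (det (word_matrix T w))\<^sup>2)" by (simp add: sum_words_det_square s_def)
    also have "\<dots> = (\<Sum>D\<in>?G. \<Sum>w\<in>?C D. (det (word_matrix T w))\<^sup>2)"
      by (rule sum.image_gen) simp
    also have "\<dots> = (\<Sum>D\<in>?G. real (card (?C D)) * (det D)\<^sup>2)"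
      by (intro sum.cong refl) simp
    also have "\<dots> \<le> (\<Sum>D\<in>?G. 1)" by (intro sum_mono le)
    also have "\<dots> = real (card ?G)" by simp
    also have "\<dots> \<le> real ((n + 1) ^ CARD('m))" using G by (simp only: of_nat_le_iff)
    finally show False using n(2) by simp
  qed
  then show thesis using that n(1) by blast
qed

section \<open>Linear forms in the translations\<close>

abbreviation word_point :: "('m::finite \<Rightarrow> real^'d^'d) \<Rightarrow> 'm list \<Rightarrow> real^'d^'m \<Rightarrow> real^'d" where
  "word_point T \<equiv> code_point T (\<lambda>i a. a $ i)"

lemma word_point_append:
  "word_point T (p @ q) a = word_point T p a + word_matrix T p *v word_point T q a"
  by (induction p) (auto simp: matrix_vector_right_distrib matrix_vector_mul_assoc add.assoc)

text \<open>A linear map \<open>f\<close> of the translations has the form \<open>a \<mapsto> \<Sum>\<^sub>i M\<^sub>i a\<^sub>i\<close>; this is the sum of the operator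
  norms of the coefficients \<open>M\<^sub>i\<close>. Adding a single letter increases the sum by at most \<open>1\<close>, no matter
  how the letters are distributed.\<close>

definition coefficient_sum :: "(real^'d^'m \<Rightarrow> real^'d) \<Rightarrow> real" where
  "coefficient_sum f = (\<Sum>i\<in>UNIV. onorm (\<lambda>x. f (axis i x)))"

definition bounded_form :: "real \<Rightarrow> (real^'d^'m::finite \<Rightarrow> real^'d) \<Rightarrow> bool" where
  "bounded_form \<kappa> f \<longleftrightarrow> linear f \<and> coefficient_sum f \<le> \<kappa>"

lemma linear_axis: "linear (axis i :: real^'d \<Rightarrow> real^'d^'m)"
  by (intro linearI) (auto simp: axis_def vec_eq_iff)

lemma bounded_linear_axis_comp:
  fixes f :: "real^'d^'m::finite \<Rightarrow> real^'d"
  assumes "linear f"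
  shows "bounded_linear (\<lambda>x. f (axis i x))"
  using linear_compose[OF linear_axis assms] by (simp add: linear_conv_bounded_linear o_def)

lemma onorm_coefficient_mult_le:
  fixes f :: "real^'d^'m::finite \<Rightarrow> real^'d"
  assumes "\<And>x. norm (A *v x) \<le> t * norm x" "0 \<le> t" "linear f"
  shows "onorm (\<lambda>x. A *v f (axis k x)) \<le> t * onorm (\<lambda>x. f (axis k x))"
proof (rule onorm_le)
  fix x
  have "norm (A *v f (axis k x)) \<le> t * norm (f (axis k x))" by (rule assms(1))
  also have "\<dots> \<le> t * (onorm (\<lambda>x. f (axis k x)) * norm x)"
    by (intro mult_left_mono assms onorm bounded_linear_axis_comp)
  finally show "norm (A *v f (axis k x)) \<le> t * onorm (\<lambda>x. f (axis k x)) * norm x" by (simp add: mult.assoc)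
qed

lemma coefficient_sum_mult_le:
  fixes f :: "real^'d^'m::finite \<Rightarrow> real^'d"
  assumes "\<And>x. norm (A *v x) \<le> t * norm x" "0 \<le> t" "linear f"
  shows "coefficient_sum (\<lambda>a. A *v f a) \<le> t * coefficient_sum f"
  unfolding coefficient_sum_def sum_distrib_left
  by (intro sum_mono onorm_coefficient_mult_le[OF assms])

lemma linear_mult_comp: "linear f \<Longrightarrow> linear (\<lambda>a. A *v f a)"
  for f :: "'a::real_vector \<Rightarrow> real^'d"
  using linear_compose[of f "(*v) A"] by (simp add: o_def)

lemma coefficient_sum_nonneg: "linear f \<Longrightarrow> 0 \<le> coefficient_sum f"
  unfolding coefficient_sum_def by (intro sum_nonneg onorm_pos_le bounded_linear_axis_comp)

lemma bounded_form_0: "0 \<le> \<kappa> \<Longrightarrow> bounded_form \<kappa> (\<lambda>_. 0)"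
  by (simp add: bounded_form_def coefficient_sum_def onorm_zero linear_zero)

lemma bounded_form_mult:
  assumes "bounded_form \<kappa> f" "\<And>x. norm (A *v x) \<le> t * norm x" "0 \<le> t" "t \<le> 1"
  shows "bounded_form \<kappa> (\<lambda>a. A *v f a)"
proof -
  have lf: "linear f" "coefficient_sum f \<le> \<kappa>" using assms(1) by (auto simp: bounded_form_def)
  have "coefficient_sum (\<lambda>a. A *v f a) \<le> t * coefficient_sum f"
    by (rule coefficient_sum_mult_le[OF assms(2,3) lf(1)])
  also have "\<dots> \<le> 1 * coefficient_sum f"
    using assms(4) coefficient_sum_nonneg[OF lf(1)] by (rule mult_right_mono)
  finally show ?thesis using lf linear_mult_comp[OF lf(1)] by (simp add: bounded_form_def)
qed

text \<open>With \<open>\<kappa> = 1 / (1 - t)\<close> the hypothesis \<open>1 + t \<kappa> \<le> \<kappa>\<close> is an equality, so prepending letters keeps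
  the coefficient sum below the geometric series \<open>1 + t + t\<^sup>2 + \<dots>\<close>.\<close>

lemma bounded_form_translate_mult:
  fixes f :: "real^'d^'m::finite \<Rightarrow> real^'d"
  assumes "bounded_form \<kappa> f" "\<And>x. norm (A *v x) \<le> t * norm x" "0 \<le> t" "1 + t * \<kappa> \<le> \<kappa>"
  shows "bounded_form \<kappa> (\<lambda>a. a $ i + A *v f a)"
proof -
  have lf: "linear f" "coefficient_sum f \<le> \<kappa>" using assms(1) by (auto simp: bounded_form_def)
  have lA: "linear (\<lambda>a. A *v f a)" by (rule linear_mult_comp[OF lf(1)])
  have lin: "linear (\<lambda>a. a $ i + A *v f a)"
    by (intro linear_compose_add lA) (auto intro: linearI)
  have one: "onorm (\<lambda>x. axis k x $ i + A *v f (axis k x))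
      \<le> (if k = i then 1 else 0) + onorm (\<lambda>x. A *v f (axis k x))" for k
  proof (rule onorm_le)
    fix x :: "real^'d"
    have "norm (axis k x $ i + A *v f (axis k x)) \<le> norm (axis k x $ i) + norm (A *v f (axis k x))"
      by (rule norm_triangle_ineq)
    also have "norm (axis k x $ i) = (if k = i then 1 else 0) * norm x"
      by (simp add: axis_def)
    also have "norm (A *v f (axis k x)) \<le> onorm (\<lambda>x. A *v f (axis k x)) * norm x"
      by (rule onorm[OF bounded_linear_axis_comp[OF lA]])
    finally show "norm (axis k x $ i + A *v f (axis k x))
        \<le> ((if k = i then 1 else 0) + onorm (\<lambda>x. A *v f (axis k x))) * norm x"
      by (simp add: algebra_simps)
  qed
  have "coefficient_sum (\<lambda>a. a $ i + A *v f a) \<le> 1 + coefficient_sum (\<lambda>a. A *v f a)"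
  proof -
    have "coefficient_sum (\<lambda>a. a $ i + A *v f a)
        \<le> (\<Sum>k\<in>UNIV. (if k = i then 1 else 0) + onorm (\<lambda>x. A *v f (axis k x)))"
      unfolding coefficient_sum_def by (intro sum_mono one)
    then show ?thesis by (simp add: coefficient_sum_def sum.distrib)
  qed
  also have "\<dots> \<le> 1 + t * coefficient_sum f"
    using coefficient_sum_mult_le[OF assms(2,3) lf(1)] by simp
  also have "\<dots> \<le> 1 + t * \<kappa>" using mult_left_mono[OF lf(2) assms(3)] by simp
  finally show ?thesis using lin assms(4) by (simp add: bounded_form_def)
qed

lemma bounded_form_norm_le:
  fixes f :: "real^'d^'m::finite \<Rightarrow> real^'d"
  assumes "bounded_form \<kappa> f"
  shows "norm (f a) \<le> \<kappa> * norm a"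
proof -
  have lf: "linear f" "coefficient_sum f \<le> \<kappa>" using assms by (auto simp: bounded_form_def)
  have "(\<Sum>i\<in>UNIV. axis i (a $ i)) = a"
    by (simp add: vec_eq_iff axis_def)
  then have "norm (f a) = norm (\<Sum>i\<in>UNIV. f (axis i (a $ i)))"
    by (metis linear_sum[OF lf(1)])
  also have "\<dots> \<le> (\<Sum>i\<in>UNIV. onorm (\<lambda>x. f (axis i x)) * norm a)"
  proof (rule sum_norm_le)
    fix i
    have "norm (f (axis i (a $ i))) \<le> onorm (\<lambda>x. f (axis i x)) * norm (a $ i)"
      by (rule onorm[OF bounded_linear_axis_comp[OF lf(1)]])
    also have "\<dots> \<le> onorm (\<lambda>x. f (axis i x)) * norm a"
      by (intro mult_left_mono Finite_Cartesian_Product.norm_nth_le onorm_pos_le bounded_linear_axis_comp lf)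
    finally show "norm (f (axis i (a $ i))) \<le> onorm (\<lambda>x. f (axis i x)) * norm a" .
  qed
  also have "\<dots> \<le> \<kappa> * norm a"
    using lf(2) by (simp add: coefficient_sum_def sum_distrib_right[symmetric] mult_right_mono)
  finally show ?thesis .
qed

text \<open>Two words that differ first in the letters \<open>i\<close> and \<open>j\<close> give a difference whose coefficients of
  \<open>a\<^sub>i\<close> and \<open>a\<^sub>j\<close> are \<open>I\<close> and \<open>-I\<close> up to errors with norms \<open>e i\<close> and \<open>e j\<close>. Both errors together are at most
  \<open>2 t \<kappa>\<close>, so the smaller one is at most \<open>t \<kappa>\<close>. Bounding them separately would only give \<open>2 t \<kappa>\<close>,
  which suffices for \<open>t < 1/3\<close> but not for \<open>t < 1/2\<close>.\<close>

lemma difference_form_expanding: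
  fixes f g :: "real^'d^'m::finite \<Rightarrow> real^'d"
  assumes ij: "i \<noteq> j" and f: "bounded_form \<kappa> f" and g: "bounded_form \<kappa> g"
    and A: "\<And>x. norm (A *v x) \<le> t * norm x" and B: "\<And>x. norm (B *v x) \<le> t * norm x" and t: "0 \<le> t"
  shows "\<exists>k. \<forall>x. (1 - t * \<kappa>) * norm x \<le>
    norm ((axis k x $ i + A *v f (axis k x)) - (axis k x $ j + B *v g (axis k x)))"
proof -
  have lf: "linear f" "coefficient_sum f \<le> \<kappa>" and lg: "linear g" "coefficient_sum g \<le> \<kappa>"
    using f g by (auto simp: bounded_form_def)
  define e where "e = (\<lambda>k. onorm (\<lambda>x. A *v f (axis k x)) + onorm (\<lambda>x. B *v g (axis k x)))"
  have lA: "linear (\<lambda>a. A *v f a)" and lB: "linear (\<lambda>a. B *v g a)"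
    using lf lg by (auto intro: linear_mult_comp)
  have e0: "0 \<le> e k" for k
    unfolding e_def using lA lB by (intro add_nonneg_nonneg onorm_pos_le bounded_linear_axis_comp)
  have "e i + e j = sum e {i, j}" using ij by simp
  also have "\<dots> \<le> sum e UNIV" using e0 by (intro sum_mono2) auto
  also have "\<dots> = coefficient_sum (\<lambda>a. A *v f a) + coefficient_sum (\<lambda>a. B *v g a)"
    by (simp add: e_def coefficient_sum_def sum.distrib)
  also have "\<dots> \<le> t * coefficient_sum f + t * coefficient_sum g"
    using A B t lf lg by (intro add_mono coefficient_sum_mult_le)
  also have "\<dots> \<le> t * \<kappa> + t * \<kappa>" using t lf lg by (intro add_mono mult_left_mono)
  finally have "e i \<le> t * \<kappa> \<or> e j \<le> t * \<kappa>" by linarith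
  then obtain k where k: "k = i \<or> k = j" "e k \<le> t * \<kappa>" by blast
  have "(1 - t * \<kappa>) * norm x \<le>
    norm ((axis k x $ i + A *v f (axis k x)) - (axis k x $ j + B *v g (axis k x)))" for x :: "real^'d"
  proof -
    let ?E = "A *v f (axis k x) - B *v g (axis k x)"
    have "norm ?E \<le> norm (A *v f (axis k x)) + norm (B *v g (axis k x))" by (rule norm_triangle_ineq4)
    also have "\<dots> \<le> onorm (\<lambda>x. A *v f (axis k x)) * norm x + onorm (\<lambda>x. B *v g (axis k x)) * norm x"
      by (intro add_mono onorm[OF bounded_linear_axis_comp[OF lA]] onorm[OF bounded_linear_axis_comp[OF lB]])
    also have "\<dots> = e k * norm x" by (simp add: e_def algebra_simps)
    also have "\<dots> \<le> t * \<kappa> * norm x" using k(2) by (intro mult_right_mono) auto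
    finally have E: "norm ?E \<le> t * \<kappa> * norm x" .
    have main: "norm (axis k x $ i - axis k x $ j) = norm x"
      using k(1) ij by (auto simp: axis_def)
    have "norm (axis k x $ i - axis k x $ j) - norm ?E \<le> norm ((axis k x $ i - axis k x $ j) + ?E)"
      by (metis add_diff_cancel_right' diff_add_cancel norm_triangle_ineq2 norm_diff_ineq)
    also have "(axis k x $ i - axis k x $ j) + ?E
        = (axis k x $ i + A *v f (axis k x)) - (axis k x $ j + B *v g (axis k x))" by simp
    finally show ?thesis using E main by (simp add: algebra_simps)
  qed
  then show ?thesis by blast
qed

lemma bounded_form_word:
  fixes T :: "'m::finite \<Rightarrow> real^'d^'d"
  assumes contr: "\<And>i x. norm (T i *v x) \<le> t * norm x" and t: "0 \<le> t" "1 + t * \<kappa> \<le> \<kappa>"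
    and f: "bounded_form \<kappa> f"
  shows "bounded_form \<kappa> (\<lambda>a. word_point T w a + word_matrix T w *v f a)"
proof (induction w)
  case (Cons i w)
  have "bounded_form \<kappa> (\<lambda>a. a $ i + T i *v (word_point T w a + word_matrix T w *v f a))"
    by (rule bounded_form_translate_mult[OF Cons contr t])
  then show ?case by (simp add: matrix_vector_right_distrib matrix_vector_mul_assoc add.assoc)
qed (use f in simp)

lemma norm_word_matrix_le:
  assumes "\<And>i x. norm (T i *v x) \<le> t * norm x" "0 \<le> t"
  shows "norm (word_matrix T w *v x) \<le> t ^ length w * norm x"
proof (induction w)
  case (Cons i w)
  have "norm (T i *v (word_matrix T w *v x)) \<le> t * norm (word_matrix T w *v x)" by (rule assms)
  also have "\<dots> \<le> t * (t ^ length w * norm x)" using Cons assms(2) by (rule mult_left_mono)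
  finally show ?case by (simp add: matrix_vector_mul_assoc mult.assoc)
qed simp

lemma norm_word_matrix_ge:
  assumes "\<And>i x. \<tau> * norm x \<le> norm (T i *v x)" "0 \<le> \<tau>"
  shows "\<tau> ^ length w * norm x \<le> norm (word_matrix T w *v x)"
proof (induction w)
  case (Cons i w)
  have "\<tau> * (\<tau> ^ length w * norm x) \<le> \<tau> * norm (word_matrix T w *v x)" using Cons assms(2) by (rule mult_left_mono)
  also have "\<dots> \<le> norm (T i *v (word_matrix T w *v x))" by (rule assms)
  finally show ?case by (simp add: matrix_vector_mul_assoc mult.assoc)
qed simp

section \<open>Transversality for the homogeneous subsystem\<close>

text \<open>Digits are words of equal length, so distinct digits split at letters \<open>i \<noteq> j\<close> after a common prefix
  \<open>p\<close>, and \<open>\<pi> (w # u)\<close> factors through the matrix of \<open>p\<close>: since \<open>D\<close> is the matrix of \<open>w = p @ i # q\<close>,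
  also \<open>D\<^sup>2\<close> begins with the matrix of \<open>p\<close>. What remains is a difference form as in
  \<open>difference_form_expanding\<close>, and prefixes of bounded length cost a bounded factor.\<close>

lemma homogeneous_class_transversal:
  fixes T :: "'m::finite \<Rightarrow> real^'d^'d"
  assumes contr: "\<And>i x. norm (T i *v x) \<le> t * norm x" and t: "0 \<le> t" "t < 1/2"
    and inv: "\<And>i. invertible (T i)"
    and W: "W = {w \<in> words UNIV n. word_matrix T w = D}"
  defines "\<pi> \<equiv> code_point (\<lambda>_. D ** D) (word_point T)"
  obtains C where "0 \<le> C" "\<And>w v u u' X. \<lbrakk>w \<in> W; v \<in> W; w \<noteq> v; set u \<subseteq> W; set u' \<subseteq> W; compact X\<rbrakk> \<Longrightarrow>
    measure lborel {a \<in> cball 0 r. \<pi> (w # u) a - \<pi> (v # u') a \<in> X} \<le> C * measure lborel X"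
proof -
  define \<kappa> where "\<kappa> = 1 / (1 - t)"
  have \<kappa>: "0 \<le> \<kappa>" "1 + t * \<kappa> \<le> \<kappa>" "t * \<kappa> < 1"
    using t by (auto simp: \<kappa>_def field_simps)
  have t1: "t \<le> 1" using t by simp
  obtain \<tau> where \<tau>: "0 < \<tau>" "\<And>i (x::real^'d). \<tau> * norm x \<le> norm (T i *v x)"
  proof -
    have "\<exists>B>0. \<forall>x. norm x * B \<le> norm (T i *v x)" for i
      using linear_inj_bounded_below_pos[OF matrix_vector_mul_linear[of "T i"] inj_matrix_vector_mult[OF inv[of i]]]
      by (metis mult.commute)
    then obtain B where B: "\<And>i. 0 < B i" "\<And>i x. norm x * B i \<le> norm (T i *v x)" by metis
    show thesis
    proof (rule that)
      show "0 < Min (range B)" using B(1) by (subst Min_gr_iff) auto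
      fix i and x :: "real^'d"
      have "Min (range B) * norm x \<le> B i * norm x" by (intro mult_right_mono Min_le) auto
      then show "Min (range B) * norm x \<le> norm (T i *v x)" using B(2)[of x i] by (simp add: mult.commute)
    qed
  qed
  have form_\<pi>: "bounded_form \<kappa> (\<pi> u)" if "set u \<subseteq> W" for u
    using that
  proof (induction u)
    case Nil
    have "\<pi> [] = (\<lambda>_. 0)" by (simp add: \<pi>_def fun_eq_iff)
    then show ?case using \<kappa> by (simp add: bounded_form_0)
  next
    case (Cons w u)
    then have D: "D = word_matrix T w" using W by auto
    have "bounded_form \<kappa> (\<lambda>a. word_point T w a + word_matrix T w *v (D *v \<pi> u a))"
    proof (rule bounded_form_word[where T = T, OF contr t(1) \<kappa>(2)])
      show "bounded_form \<kappa> (\<lambda>a. D *v \<pi> u a)"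
        unfolding D using Cons norm_word_matrix_le[where T = T, OF contr t(1)] t t1
        by (intro bounded_form_mult[where t = "t ^ length w"]) (auto intro: power_le_one)
    qed
    moreover have "\<pi> (w # u) = (\<lambda>a. word_point T w a + word_matrix T w *v (D *v \<pi> u a))"
      using D by (simp add: \<pi>_def fun_eq_iff matrix_vector_mul_assoc)
    ultimately show ?case by simp
  qed
  have split: "\<exists>g. bounded_form \<kappa> g \<and>
      (\<forall>a. \<pi> ((p @ i # q) # u) a = word_point T p a + word_matrix T p *v (a $ i + T i *v g a))"
    if "p @ i # q \<in> W" "set u \<subseteq> W" for p i q u
  proof -
    let ?w = "p @ i # q"
    have D: "D = word_matrix T ?w" using W that(1) by auto
    define g where "g = (\<lambda>a. word_point T q a + word_matrix T q *v (D *v \<pi> u a))"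
    have "bounded_form \<kappa> (\<lambda>a. D *v \<pi> u a)"
      unfolding D using form_\<pi>[OF that(2)] norm_word_matrix_le[where T = T, OF contr t(1)] t t1
      by (intro bounded_form_mult[where t = "t ^ length ?w"]) (auto intro: power_le_one simp del: length_append)
    then have "bounded_form \<kappa> g"
      unfolding g_def by (rule bounded_form_word[where T = T, OF contr t(1) \<kappa>(2)])
    moreover have "\<pi> (?w # u) a = word_point T p a + word_matrix T p *v (a $ i + T i *v g a)" for a
    proof -
      have "\<pi> (?w # u) a = word_point T ?w a + word_matrix T ?w *v (D *v \<pi> u a)"
        using D by (simp add: \<pi>_def matrix_vector_mul_assoc)
      also have "\<dots> = word_point T p a + word_matrix T p *v (a $ i + T i *v g a)"
        by (simp add: g_def word_point_append word_matrix_append matrix_vector_right_distrib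
            matrix_vector_mul_assoc matrix_mul_assoc add.assoc)
      finally show ?thesis .
    qed
    ultimately show ?thesis by blast
  qed
  \<comment> \<open>Prefixes have length at most \<open>n\<close>; replacing \<open>\<tau>\<close> by \<open>min 1 \<tau>\<close> lets one power serve them all.\<close>
  define c where "c = min 1 \<tau> ^ n * (1 - t * \<kappa>)"
  have c0: "0 < c" using \<tau> \<kappa> by (simp add: c_def)
  define C where "C = measure lborel (cball (0::real^'d^'m) (r + 1))
    / (c ^ CARD('d) * measure lborel (cball (0::real^'d) 1))"
  have "0 \<le> C" using c0 by (simp add: C_def)
  moreover have "measure lborel {a \<in> cball 0 r. \<pi> (w # u) a - \<pi> (v # u') a \<in> X} \<le> C * measure lborel X"
    if wv: "w \<in> W" "v \<in> W" "w \<noteq> v" and u: "set u \<subseteq> W" "set u' \<subseteq> W" and X: "compact X" for w v u u' X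
  proof -
    have "length w = n" "length v = n" using wv W by (auto simp: words_def)
    then obtain p i q j q' where pq: "i \<noteq> j" "w = p @ i # q" "v = p @ j # q'"
    proof -
      obtain p i q j q' where "i \<noteq> j" "w = p @ [i] @ q" "v = p @ [j] @ q'"
        using same_length_different[of w v] wv(3) \<open>length w = n\<close> \<open>length v = n\<close> by metis
      then show thesis by (intro that[of i j p q q']) auto
    qed
    obtain f where f: "bounded_form \<kappa> f"
      "\<And>a. \<pi> (w # u) a = word_point T p a + word_matrix T p *v (a $ i + T i *v f a)"
      using split[of p i q u] wv u pq by auto
    obtain g where g: "bounded_form \<kappa> g"
      "\<And>a. \<pi> (v # u') a = word_point T p a + word_matrix T p *v (a $ j + T j *v g a)"
      using split[of p j q' u'] wv u pq by auto
    define z where "z = (\<lambda>a. \<pi> (w # u) a - \<pi> (v # u') a)"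
    have z: "z a = word_matrix T p *v ((a $ i + T i *v f a) - (a $ j + T j *v g a))" for a
      unfolding z_def f(2) g(2) matrix_vector_mult_diff_distrib by simp
    have "linear z"
      unfolding z_def using form_\<pi>[of "w # u"] form_\<pi>[of "v # u'"] wv u
      by (intro linear_compose_sub) (auto simp: bounded_form_def)
    moreover obtain k where k: "\<And>x. (1 - t * \<kappa>) * norm x \<le>
        norm ((axis k x $ i + T i *v f (axis k x)) - (axis k x $ j + T j *v g (axis k x)))"
      using difference_form_expanding[OF pq(1) f(1) g(1) contr contr t(1)] by blast
    have "c * norm x \<le> norm (z (axis k x))" for x
    proof -
      let ?\<tau> = "min 1 \<tau>" and ?y = "(axis k x $ i + T i *v f (axis k x)) - (axis k x $ j + T j *v g (axis k x))"
      have \<tau>1: "?\<tau> * norm x \<le> norm (T i *v x)" for i x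
        using \<tau>(2)[of x i] mult_right_mono[of ?\<tau> \<tau> "norm x"] by simp
      have "length p \<le> n" using \<open>length w = n\<close> pq(2) by simp
      then have "?\<tau> ^ n \<le> ?\<tau> ^ length p" using \<tau>(1) by (intro power_decreasing) auto
      then have "c * norm x \<le> ?\<tau> ^ length p * ((1 - t * \<kappa>) * norm x)"
        unfolding c_def mult.assoc using \<kappa>(3) by (intro mult_right_mono) auto
      also have "\<dots> \<le> ?\<tau> ^ length p * norm ?y" using k \<tau>(1) by (intro mult_left_mono) auto
      also have "\<dots> \<le> norm (z (axis k x))"
        unfolding z using \<tau>(1) by (intro norm_word_matrix_ge \<tau>1) auto
      finally show ?thesis .
    qed
    ultimately have "measure lborel {a \<in> cball 0 r. z a \<in> X} \<le> C * measure lborel X"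
      unfolding C_def using X c0 by (intro transversal_linear_preimage)
    then show ?thesis by (simp only: z_def)
  qed
  ultimately show thesis by (rule that)
qed

section \<open>From the homogeneous subsystem to interior points\<close>

lemma norm_pow_image_le:
  assumes "\<And>x. norm (S *v x) \<le> \<theta> * norm x" "0 \<le> \<theta>" "p \<in> pow_image S n (cball 0 R)"
  shows "norm p \<le> \<theta> ^ n * R"
  using assms(3)
proof (induction n arbitrary: p)
  case (Suc n)
  then obtain q where q: "p = S *v q" "q \<in> pow_image S n (cball 0 R)" by auto
  have "norm p \<le> \<theta> * norm q" using assms(1) q by simp
  also have "\<dots> \<le> \<theta> * (\<theta> ^ n * R)" using Suc.IH[OF q(2)] assms(2) by (rule mult_left_mono)
  finally show ?case by (simp add: mult.assoc)
qed simp

text \<open>If \<open>x\<close> and \<open>y\<close> have digits \<open>w\<^sub>k\<close> and \<open>v\<^sub>k\<close> in the system with matrix \<open>D\<^sup>2\<close>, then \<open>x + D y\<close> is the point of the system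
  \<open>h \<mapsto> D h + b\<^sub>w(a)\<close> with digits \<open>w\<^sub>0, v\<^sub>0, w\<^sub>1, v\<^sub>1, \<dots>\<close>. That system consists of compositions of the
  original maps, so it preserves \<open>H\<close>; the finite interleavings applied to \<open>h0\<close> approximate \<open>x + D y\<close>.\<close>

lemma interleaved_sum_in_invariant_set:
  fixes T :: "'m::finite \<Rightarrow> real^'d^'d"
  assumes H: "closed H" "h0 \<in> H" "\<And>i x. x \<in> H \<Longrightarrow> T i *v x + a $ i \<in> H"
    and W: "\<And>w. w \<in> W \<Longrightarrow> word_matrix T w = D"
    and \<theta>: "\<And>x. norm (D *v x) \<le> \<theta> * norm x" "0 \<le> \<theta>" "\<theta> < 1"
    and x: "x \<in> (\<Inter>n. cylinder_cover W (D ** D) (word_point T) R a n)"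
    and y: "y \<in> (\<Inter>n. cylinder_cover W (D ** D) (word_point T) R a n)"
  shows "x + D *v y \<in> H"
proof -
  let ?S = "D ** D"
  let ?\<pi> = "\<lambda>u. code_point (\<lambda>_. ?S) (word_point T) u a"
  have word: "word_point T w a + word_matrix T w *v h \<in> H" if "h \<in> H" for w h
  proof (induction w)
    case (Cons i w)
    have "T i *v (word_point T w a + word_matrix T w *v h) + a $ i \<in> H" using Cons by (rule H(3))
    then show ?case by (simp add: matrix_vector_right_distrib matrix_vector_mul_assoc algebra_simps)
  qed (use that in simp)
  have S: "norm (?S *v x) \<le> \<theta> * norm x" for x
  proof -
    have "norm (D *v (D *v x)) \<le> \<theta> * norm (D *v x)" by (rule \<theta>)
    also have "\<dots> \<le> 1 * norm (D *v x)" using \<theta>(3) by (intro mult_right_mono) auto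
    also have "\<dots> \<le> \<theta> * norm x" using \<theta>(1) by simp
    finally show ?thesis by (simp add: matrix_vector_mul_assoc)
  qed
  have inter: "\<exists>h\<in>pow_image ?S n {h0}. ?\<pi> u + D *v ?\<pi> v + h \<in> H"
    if "u \<in> words W n" "v \<in> words W n" for n u v
    using that
  proof (induction n arbitrary: u v)
    case 0
    then show ?case using H(2) by simp
  next
    case (Suc n)
    then obtain w u' w' v' where uv: "u = w # u'" "v = w' # v'" "w \<in> W" "w' \<in> W"
      "u' \<in> words W n" "v' \<in> words W n" by (auto simp: words_Suc)
    obtain h where h: "h \<in> pow_image ?S n {h0}" "?\<pi> u' + D *v ?\<pi> v' + h \<in> H"
      using Suc.IH[OF uv(5,6)] by blast
    have "word_point T w a + D *v (word_point T w' a + D *v (?\<pi> u' + D *v ?\<pi> v' + h)) \<in> H"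
      using word[OF word[OF h(2), of w'], of w] W uv by simp
    moreover have "word_point T w a + D *v (word_point T w' a + D *v (?\<pi> u' + D *v ?\<pi> v' + h))
        = ?\<pi> u + D *v ?\<pi> v + ?S *v h"
      using uv by (simp add: matrix_vector_right_distrib matrix_vector_mul_assoc matrix_mul_assoc algebra_simps)
    ultimately have "?\<pi> u + D *v ?\<pi> v + ?S *v h \<in> H" by simp
    moreover have "?S *v h \<in> pow_image ?S (Suc n) {h0}" using h(1) by simp
    ultimately show ?case by blast
  qed
  have pow_mono: "pow_image ?S n A \<subseteq> pow_image ?S n B" if "A \<subseteq> B" for n and A B :: "(real^'d) set"
    using that by (induction n) (auto intro: image_mono)
  have "x + D *v y \<in> closure H"
    unfolding closure_approachable
  proof (intro allI impI)
    fix e :: real assume "0 < e"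
    let ?M = "R + R + norm h0"
    have "(\<lambda>n. \<theta> ^ n * ?M) \<longlonglongrightarrow> 0 * ?M" using \<theta> by (intro tendsto_intros LIMSEQ_power_zero) auto
    then have "eventually (\<lambda>n. \<theta> ^ n * ?M < e) sequentially" using \<open>0 < e\<close> by (simp add: order_tendstoD)
    then obtain n where n: "\<theta> ^ n * ?M < e" by (auto simp: eventually_sequentially)
    obtain u p where u: "u \<in> words W n" "p \<in> pow_image ?S n (cball 0 R)" "x = ?\<pi> u + p"
      using INT_D[OF x UNIV_I, of n] unfolding cylinder_cover_def by blast
    obtain v q where v: "v \<in> words W n" "q \<in> pow_image ?S n (cball 0 R)" "y = ?\<pi> v + q"
      using INT_D[OF y UNIV_I, of n] unfolding cylinder_cover_def by blast
    obtain h where h: "h \<in> pow_image ?S n {h0}" "?\<pi> u + D *v ?\<pi> v + h \<in> H"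
      using inter[OF u(1) v(1)] by blast
    have "h \<in> pow_image ?S n (cball 0 (norm h0))" using h(1) pow_mono[of "{h0}" "cball 0 (norm h0)"] by auto
    then have nh: "norm h \<le> \<theta> ^ n * norm h0" by (rule norm_pow_image_le[OF S \<theta>(2)])
    have np: "norm p \<le> \<theta> ^ n * R" "norm q \<le> \<theta> ^ n * R"
      using u v norm_pow_image_le[OF S \<theta>(2)] by auto
    have nq: "norm (D *v q) \<le> \<theta> ^ n * R"
      using \<theta>(1)[of q] mult_right_mono[of \<theta> 1 "norm q"] \<theta>(3) np(2) by simp
    have "(?\<pi> u + D *v ?\<pi> v + h) - (x + D *v y) = h - p - D *v q"
      using u v by (simp add: matrix_vector_right_distrib)
    then have "dist (?\<pi> u + D *v ?\<pi> v + h) (x + D *v y) = norm (h - p - D *v q)"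
      by (simp only: dist_norm)
    also have "\<dots> \<le> norm h + norm p + norm (D *v q)"
      using norm_triangle_ineq4[of "h - p" "D *v q"] norm_triangle_ineq4[of h p] by linarith
    also have "\<dots> \<le> \<theta> ^ n * ?M" using nh np(1) nq by (simp add: algebra_simps)
    finally show "\<exists>z\<in>H. dist z (x + D *v y) < e" using h(2) n by force
  qed
  then show ?thesis using H(1) by (simp add: closure_closed)
qed

theorem theorem1p3:
  fixes T :: "'m::finite \<Rightarrow> real^'d^'d"
  assumes "\<And>i. invertible (T i)"
    and "\<And>i. onorm (\<lambda>x. T i *v x) < 1/2"
    and "\<And>i j. T i ** T j = T j ** T i"
    and "(\<Sum>i\<in>UNIV. \<bar>det (T i)\<bar>^2) > 1"
  shows "AE a in (lebesgue :: (real^'d^'m) measure). interior (self_affine_set T a) \<noteq> {}"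
proof -
  define t where "t = Max (range (\<lambda>i. onorm (\<lambda>x. T i *v x)))"
  have bl: "bounded_linear (\<lambda>x. T i *v x)" for i by (rule matrix_vector_mul_bounded_linear)
  have ti: "onorm (\<lambda>x. T i *v x) \<le> t" for i unfolding t_def by (intro Max_ge) auto
  have "t \<in> range (\<lambda>i. onorm (\<lambda>x. T i *v x))" unfolding t_def by (intro Max_in) auto
  then have t: "0 \<le> t" "t < 1/2" using assms(2) onorm_pos_le[OF bl] by auto
  have contr: "norm (T i *v x) \<le> t * norm x" for i x
    using onorm[OF bl, of i x] mult_right_mono[OF ti[of i], of "norm x"] by simp
  obtain n D where n: "1 \<le> n" and big: "1 < real (card {w \<in> words UNIV n. word_matrix T w = D}) * (det D)\<^sup>2"
  proof (rule exists_large_homogeneous_class[where T = T, OF assms(3)])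
    show "1 < (\<Sum>i\<in>UNIV. (det (T i))\<^sup>2)" using assms(4) by simp
  qed blast
  define W where "W = {w \<in> words UNIV n. word_matrix T w = D}"
  have finW: "finite W" by (simp add: W_def)
  have "W \<noteq> {}"
  proof
    assume "W = {}"
    with big show False by (simp add: W_def[symmetric])
  qed
  then obtain w0 where w0: "w0 \<in> W" by blast
  let ?S = "D ** D"
  have detS: "\<bar>det ?S\<bar> = (det D)\<^sup>2" by (simp add: det_mul power2_eq_square)
  have bigS: "1 < real (card W) * \<bar>det ?S\<bar>" using big by (simp add: detS W_def)
  have detD: "det D \<noteq> 0" using bigS unfolding detS by auto
  have D: "norm (D *v x) \<le> 1/2 * norm x" for x
  proof -
    have "norm (D *v x) \<le> t ^ n * norm x"
      using norm_word_matrix_le[where T = T, OF contr t(1), where w = w0 and x = x] w0 by (simp add: W_def words_def)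
    also have "t ^ n \<le> t ^ 1" using n t by (intro power_decreasing) auto
    then have "t ^ n * norm x \<le> 1/2 * norm x" using t by (intro mult_right_mono) auto
    finally show ?thesis .
  qed
  define \<kappa> where "\<kappa> = 1 / (1 - t)"
  have \<kappa>: "0 < \<kappa>" "1 + t * \<kappa> \<le> \<kappa>" using t by (auto simp: \<kappa>_def field_simps)
  have form: "bounded_form \<kappa> (word_point T w)" for w
    using bounded_form_word[where T = T, OF contr t(1) \<kappa>(2) bounded_form_0, where w = w] \<kappa>(1) by simp
  \<comment> \<open>For \<open>norm a \<le> r\<close> the digits have norm at most \<open>\<kappa> r\<close> and \<open>D\<^sup>2\<close> contracts by at least \<open>1/2\<close>, so the
    ball of radius \<open>2 \<kappa> r\<close> is mapped into itself.\<close>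
  define A where "A = (\<lambda>r a. \<Inter>k. cylinder_cover W ?S (word_point T) (2 * \<kappa> * r) a k)"
  have pos: "AE a in lborel. a \<in> cball 0 r \<longrightarrow> 0 < measure lborel (A r a)" if r: "0 < r" for r
  proof (rule homogeneous_class_transversal[where T = T, OF contr t assms(1) W_def, where r = r])
    fix C :: real
    assume C: "0 \<le> C" and transv: "\<And>w v u u' X. \<lbrakk>w \<in> W; v \<in> W; w \<noteq> v; set u \<subseteq> W; set u' \<subseteq> W; compact X\<rbrakk> \<Longrightarrow>
      measure lborel {a \<in> cball 0 r. code_point (\<lambda>_. ?S) (word_point T) (w # u) a
        - code_point (\<lambda>_. ?S) (word_point T) (v # u') a \<in> X} \<le> C * measure lborel X"
    show ?thesis
      unfolding A_def
    proof (rule AE_positive_measure_attractor[OF finW _ _ bigS _ C _ transv])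
      show "continuous_on UNIV (word_point T w)" for w
        using form[of w] by (intro linear_continuous_on) (auto simp: bounded_form_def linear_conv_bounded_linear)
      show "invertible ?S" using detD by (simp add: invertible_det_nz det_mul)
      show "0 < 2 * \<kappa> * r" using r \<kappa>(1) by simp
      fix a :: "real^'d^'m" and w and x :: "real^'d" assume a: "a \<in> cball 0 r" and x: "norm x \<le> 2 * \<kappa> * r"
      have "norm (word_point T w a) \<le> \<kappa> * norm a" by (rule bounded_form_norm_le[OF form])
      also have "\<dots> \<le> \<kappa> * r" using a \<kappa>(1) by (intro mult_left_mono) auto
      finally have "norm (word_point T w a) \<le> \<kappa> * r" .
      moreover have "norm (?S *v x) \<le> 1/2 * norm x"
        using D[of "D *v x"] D[of x] norm_ge_zero[of "D *v x"] unfolding matrix_vector_mul_assoc by linarith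
      ultimately show "norm (word_point T w a + ?S *v x) \<le> 2 * \<kappa> * r"
        using norm_triangle_ineq[of "word_point T w a" "?S *v x"] x by linarith
    qed auto
  qed
  have "AE a in lborel. \<forall>k::nat. a \<in> cball 0 (real k + 1) \<longrightarrow> 0 < measure lborel (A (real k + 1) a)"
    unfolding AE_all_countable by (intro allI pos) simp
  then have "AE a in (lborel :: (real^'d^'m) measure). interior (self_affine_set T a) \<noteq> {}"
  proof (rule AE_mp, intro AE_I2 impI)
    fix a :: "real^'d^'m"
    assume all: "\<forall>k::nat. a \<in> cball 0 (real k + 1) \<longrightarrow> 0 < measure lborel (A (real k + 1) a)"
    obtain k :: nat where "norm a \<le> real k" using real_arch_simple by blast
    define r where "r = real k + 1"
    have Apos: "0 < measure lborel (A r a)" using all \<open>norm a \<le> real k\<close> by (auto simp: r_def)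
    have cA: "compact (A r a)"
      unfolding A_def using finW by (intro compact_Inter) (auto intro: compact_cylinder_cover)
    have lD: "linear ((*v) D)" by (rule matrix_vector_mul_linear)
    let ?H = "self_affine_set T a"
    have t1: "t < 1" using t by simp
    note H = self_affine_set_props[where T = T, OF assms(1) t(1) t1 contr, where a = a]
    obtain h0 where h0: "h0 \<in> ?H" using H(1) by blast
    show "interior ?H \<noteq> {}"
    proof (rule sumset_interior_nonempty[OF cA compact_linear_image[OF lD cA] Apos])
      show "0 < measure lborel ((*v) D ` A r a)"
        using Apos detD by (simp add: measure_linear_image_compact[OF lD cA])
      fix x y assume x: "x \<in> A r a" and "y \<in> (*v) D ` A r a"
      then obtain y' where y': "y = D *v y'" "y' \<in> A r a" by blast
      show "x + y \<in> ?H"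
        unfolding y'(1)
      proof (rule interleaved_sum_in_invariant_set[OF _ h0 H(3) _ D])
        show "closed ?H" using H(2) by (rule compact_imp_closed)
        show "word_matrix T w = D" if "w \<in> W" for w using that by (simp add: W_def)
      qed (use x y' in \<open>auto simp: A_def\<close>)
    qed
  qed
  then show ?thesis by (rule AE_completion)
qed

end
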